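(* Let $N,n\ge 1$, let $J_1,\dots,J_N\subseteq\{1,\dots,n\}$ be ordered sets with $\bigcup_i J_i=\{1,\dots,n\}$, and let the data of a coupled semidefinite program together with current primal-dual iterates be given as in the context, defining for each $i=1,\dots,N$ the matrices $\mathcal Q^i$, $U^i$, $F^i$ and the vectors $r^i$, $r^i_{\mathrm{primal}}$. Let $\mathcal Q,\mathbf U,\mathbf F$ be the block-diagonal matrices with diagonal blocks $\mathcal Q^i,U^i,F^i$ respectively, let $\mathbf r=(r^1,\dots,r^N)$, $\mathbf r_{\mathrm{primal}}=(r^1_{\mathrm{primal}},\dots,r^N_{\mathrm{primal}})$, and let $\bar{\mathcal E}$ be the matrix with $\bar{\mathcal E}^T=\begin{bmatrix}(E_{J_1}\otimes_s E_{J_1})^T&\cdots&(E_{J_N}\otimes_s E_{J_N})^T\end{bmatrix}$. Let $\Delta x=\mathrm{svec}(\Delta X)$ be a solution of $$\min_{\Delta x}\ \sum_{i=1}^N \tfrac12(\Delta x^i)^T(F^i)^{-1}U^i\Delta x^i+(r^i)^T\Delta x^i\quad\text{subject to}\quad \mathcal Q^i\Delta x^i=r^i_{\mathrm{primal}},\ i=1,\dots,N,$$ where $\Delta x^i:=\mathrm{svec}(\Delta X_{J_iJ_i})$, and let $\Delta\mathbf v=(\Delta v^1,\dots,\Delta v^N)$ be corresponding dual variables (Lagrange multipliers of the equality constraints, with the sign convention given in the context). Define, for $i=1,\dots,N$, $$\Delta\bar X^i=\Delta X_{J_iJ_i},\qquad \Delta\bar x^i=\mathrm{svec}(\Delta\bar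 X^i),\qquad \Delta\bar v^i=(F^i)^{-1}U^i\Delta\bar x^i+r^i-(\mathcal Q^i)^T\Delta v^i,$$ and set $\Delta\bar{\mathbf x}=(\Delta\bar x^1,\dots,\Delta\bar x^N)$, $\Delta\bar{\mathbf v}=(\Delta\bar v^1,\dots,\Delta\bar v^N)$. Then $$\begin{bmatrix}-\mathbf F^{-1}\mathbf U&0&\mathcal Q^T&I\\0&0&0&-\bar{\mathcal E}^T\\ \mathcal Q&0&0&0\\ I&-\bar{\mathcal E}&0&0\end{bmatrix}\begin{bmatrix}\Delta\bar{\mathbf x}\\ \Delta x\\ \Delta\mathbf v\\ \Delta\bar{\mathbf v}\end{bmatrix}=\begin{bmatrix}\mathbf r\\0\\ \mathbf r_{\mathrm{primal}}\\0\end{bmatrix}.$$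
   Context: **Notation.** $\mathbb S^n$ is the set of real symmetric $n\times n$ matrices. For $X\in\mathbb S^n$, $\mathrm{svec}(X)=(X_{11},\sqrt2X_{21},\dots,\sqrt2X_{n1},X_{22},\sqrt2X_{32},\dots,\sqrt2X_{n2},\dots,X_{nn})$, and $\mathrm{smat}$ is the inverse of $\mathrm{svec}$; $\mathrm{vec}$ stacks columns. For matrices of equal size, $X\bullet Y=\mathrm{vec}(X)^T\mathrm{vec}(Y)$. For $J\subseteq\{1,\dots,n\}$, $E_J\in\mathbb R^{|J|\times n}$ is the identity matrix with the rows not indexed by $J$ removed, and $X_{JJ}=E_JXE_J^T$. The symmetrized Kronecker product of $P,R\in\mathbb R^{k\times n}$ is the matrix $P\otimes_s R$ characterized by $(P\otimes_s R)\,\mathrm{svec}(K)=\mathrm{svec}\big(\tfrac12(RKP^T+PKR^T)\big)$ for all $K\in\mathbb S^n$; equivalently $P\otimes_s R=\tfrac12 T_k(P\otimes R+R\otimes P)T_n^T$, where $T_n$ is the $\frac{n(n+1)}2\times n^2$ matrix with orthonormal rows satisfying $T_n\mathrm{vec}(X)=\mathrm{svec}(X)$ for $X\in\mathbb S^n$. In particular $\mathrm{svec}(X_{JJ})=(E_J\otimes_sE_J)\,\mathrm{svec}(X)$. For invertible $D$, $H_D(M)=\tfrac12(DMD^{-1}+D^{-T}M^TD^T)$. Lowercase letters denote $\mathrm{svec}$ of the corresponding uppercase symmetric matrices (e.g. $\bar x^i=\mathrm{svec}(\bar X^i)$, $r^i_{\mathrm{dual}}=\mathrm{svec}(R^i_{\mathrm{dual}})$).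 **Coupled SDP.** The problem is to minimize $\sum_{i=1}^N W^i\bullet X_{J_iJ_i}$ subject to $Q^i_j\bullet X_{J_iJ_i}=b^i_j$ ($j=1,\dots,m_i$) and $X_{J_iJ_i}\succeq0$, $i=1,\dots,N$, where $W^i,Q^i_j\in\mathbb S^{|J_i|}$, $b^i\in\mathbb R^{m_i}$, and the matrix $\mathcal Q^i:=\begin{bmatrix}\mathrm{svec}(Q^i_1)&\cdots&\mathrm{svec}(Q^i_{m_i})\end{bmatrix}^T$ has full row rank. The variable $X\in\mathbb S^n$ satisfies $X_{jk}=0$ whenever there is no $i$ with $\{j,k\}\subseteq J_i$; the direction $\Delta X$ ranges over the same subspace of $\mathbb S^n$. The problem is rewritten with local copies $\bar X^i=X_{J_iJ_i}$. **Iterates.** The current iterates are $X$, $\bar X^i=X_{J_iJ_i}\succ0$, $S^i\succ0$ (in $\mathbb S^{|J_i|}$), $v^i\in\mathbb R^{m_i}$, and $\bar v^i\in\mathbb R^{|J_i|(|J_i|+1)/2}$ with $\sum_i(E_{J_i}\otimes_sE_{J_i})^T\bar v^i=0$. The Nesterov–Todd scaling matrix is $D^i=(G^i)^{-1}$, where $G^i(G^i)^T=(\bar X^i)^{1/2}\big((\bar X^i)^{1/2}S^i(\bar X^i)^{1/2}\big)^{-1/2}(\bar X^i)^{1/2}$. Set $$U^i=D^i\otimes_s(D^i)^{-T}S^i,\qquad F^i=D^i\bar X^i\otimes_s(D^i)^{-T}$$ (products inside are formed before $\otimes_s$). Here $F^i$ is invertible and $(F^i)^{-1}U^i$ is symmetric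 positive definite. **Residuals.** With $\delta=\sigma\mu$, $\sigma\in[0,1]$, $\mu=\sum_i\bar X^i\bullet S^i/\sum_j|J_j|$: $r^i_{\mathrm{primal}}=b^i-\mathcal Q^i\bar x^i$, $R^i_{\mathrm{dual}}=W^i-\sum_jv^i_jQ^i_j+\mathrm{smat}(\bar v^i)-S^i$, $R^i_{\mathrm{cent}}=\delta I-H_{D^i}(\bar X^iS^i)$. For the predictor directions ($\sigma=0$), $r^i=r^i_{\mathrm{dual}}-(F^i)^{-1}r^i_{\mathrm{cent}}$; the associated slack direction is $\Delta s^i=(F^i)^{-1}(r^i_{\mathrm{cent}}-U^i\Delta\bar x^i)$. For the corrector directions (with an updated $\sigma$), $r^i=r^i_{\mathrm{dual}}-(F^i)^{-1}\big(r^i_{\mathrm{cent}}-\mathrm{svec}(H_{D^i}(\Delta\bar X^i_{\mathrm{pred}}\Delta S^i_{\mathrm{pred}}))\big)$, where $\Delta\bar X^i_{\mathrm{pred}},\Delta S^i_{\mathrm{pred}}$ are the predictor directions. The claim applies to either choice of $r^i$ (used consistently in the optimization problem, in the definition of $\Delta\bar v^i$, and in the linear system). **Sign convention for the dual variables.** $(\Delta x,\Delta\mathbf v)$ satisfies the optimality conditions of the reduced quadratic program in the form $$\bar{\mathcal E}^T\big(\mathbf F^{-1}\mathbf U\bar{\mathcal E}\Delta x-\mathcal Q^T\Delta\mathbf v\big)=-\bar{\mathcal E}^T\mathbf r,\qquad \mathcal Q\bar{\mathcal E}\Delta x=\mathbf r_{\mathrm{primal}},$$ i.e. the Lagrangian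 is the objective minus $\sum_i(\Delta v^i)^T(\mathcal Q^i\Delta x^i-r^i_{\mathrm{primal}})$. *)

theory Defs
  imports
    Complex_Main
    "Jordan_Normal_Form.Gauss_Jordan_Elimination"
    "Jordan_Normal_Form.DL_Submatrix"
    "Jordan_Normal_Form.DL_Rank"
begin

(* All indices are 0-based: rows and columns run over {..<n}, blocks over {..<N}. *)

section \<open>Matrix operations\<close>

definition sym_mats :: "nat \<Rightarrow> real mat set" where
  "sym_mats k = {A \<in> carrier_mat k k. A\<^sup>T = A}"

definition pos_semidef :: "real mat \<Rightarrow> bool" where
  "pos_semidef A \<longleftrightarrow> A \<in> sym_mats (dim_row A) \<and>
     (\<forall>x \<in> carrier_vec (dim_row A). x \<bullet> (A *\<^sub>v x) \<ge> 0)"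

definition pos_def :: "real mat \<Rightarrow> bool" where
  "pos_def A \<longleftrightarrow> A \<in> sym_mats (dim_row A) \<and>
     (\<forall>x \<in> carrier_vec (dim_row A). x \<noteq> 0\<^sub>v (dim_row A) \<longrightarrow> x \<bullet> (A *\<^sub>v x) > 0)"

(* Only meaningful for invertible A. *)
definition minv :: "real mat \<Rightarrow> real mat" where
  "minv A = the (mat_inverse A)"

definition msqrt :: "real mat \<Rightarrow> real mat" where
  "msqrt A = (THE B. B \<in> carrier_mat (dim_row A) (dim_row A) \<and> pos_semidef B \<and> B * B = A)"

definition tri :: "nat \<Rightarrow> nat" where
  "tri k = k * (k + 1) div 2"

(* The lower triangle, column by column. *)
definition svec :: "real mat \<Rightarrow> real vec" where
  "svec A = vec_of_list (concat
     (map (\<lambda>c. map (\<lambda>r. if r = c then A $$ (r, c) else sqrt 2 * A $$ (r, c)) [c..<dim_row A])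
       [0..<dim_row A]))"

definition smat :: "nat \<Rightarrow> real vec \<Rightarrow> real mat" where
  "smat k = the_inv_into (sym_mats k) svec"

definition vec_cols :: "real mat \<Rightarrow> real vec" where
  "vec_cols A = vec_of_list (concat (map list_of_vec (cols A)))"

definition mat_inner :: "real mat \<Rightarrow> real mat \<Rightarrow> real" where
  "mat_inner A B = vec_cols A \<bullet> vec_cols B"

definition skron :: "real mat \<Rightarrow> real mat \<Rightarrow> real mat" (infixl \<open>\<otimes>\<^sub>s\<close> 68) where
  "P \<otimes>\<^sub>s R = (THE M. M \<in> carrier_mat (tri (dim_row P)) (tri (dim_col P)) \<and>
     (\<forall>K \<in> sym_mats (dim_col P).
        M *\<^sub>v svec K = svec ((1/2) \<cdot>\<^sub>m (R * K * P\<^sup>T + P * K * R\<^sup>T))))"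

definition symmetrize :: "real mat \<Rightarrow> real mat \<Rightarrow> real mat" where
  "symmetrize D M = (1/2) \<cdot>\<^sub>m (D * M * minv D + (minv D)\<^sup>T * M\<^sup>T * D\<^sup>T)"

definition selector :: "nat \<Rightarrow> nat set \<Rightarrow> real mat" where
  "selector n J = submatrix (1\<^sub>m n) J UNIV"

definition stack_vec :: "real vec list \<Rightarrow> real vec" where
  "stack_vec vs = foldr (@\<^sub>v) vs (0\<^sub>v 0)"

definition stack_rows :: "nat \<Rightarrow> real mat list \<Rightarrow> real mat" where
  "stack_rows c As = foldr (@\<^sub>r) As (0\<^sub>m 0 c)"

section \<open>Coupled semidefinite programs\<close>

record coupled_sdp =
  nblk :: nat
  dimX :: nat
  idx :: "nat \<Rightarrow> nat set"
  ncon :: "nat \<Rightarrow> nat"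
  costW :: "nat \<Rightarrow> real mat"
  conQ :: "nat \<Rightarrow> nat \<Rightarrow> real mat"
  rhsb :: "nat \<Rightarrow> real vec"

definition bsize :: "coupled_sdp \<Rightarrow> nat \<Rightarrow> nat" where
  "bsize P i = card (idx P i)"

definition E_blk :: "coupled_sdp \<Rightarrow> nat \<Rightarrow> real mat" where
  "E_blk P i = selector (dimX P) (idx P i)"

definition sub_blk :: "coupled_sdp \<Rightarrow> real mat \<Rightarrow> nat \<Rightarrow> real mat" where
  "sub_blk P A i = E_blk P i * A * (E_blk P i)\<^sup>T"

definition Qcal :: "coupled_sdp \<Rightarrow> nat \<Rightarrow> real mat" where
  "Qcal P i = mat_of_rows (tri (bsize P i)) (map (\<lambda>j. svec (conQ P i j)) [0..<ncon P i])"

definition sparse_sym :: "coupled_sdp \<Rightarrow> real mat set" where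
  "sparse_sym P = {A \<in> sym_mats (dimX P). \<forall>j < dimX P. \<forall>k < dimX P.
     (\<nexists>i. i < nblk P \<and> {j, k} \<subseteq> idx P i) \<longrightarrow> A $$ (j, k) = 0}"

definition is_coupled_sdp :: "coupled_sdp \<Rightarrow> bool" where
  "is_coupled_sdp P \<longleftrightarrow> nblk P \<ge> 1 \<and> dimX P \<ge> 1 \<and>
     (\<Union>i<nblk P. idx P i) = {..<dimX P} \<and>
     (\<forall>i < nblk P.
        costW P i \<in> sym_mats (bsize P i) \<and>
        (\<forall>j < ncon P i. conQ P i j \<in> sym_mats (bsize P i)) \<and>
        rhsb P i \<in> carrier_vec (ncon P i) \<and>
        vec_space.rank (ncon P i) (Qcal P i) = ncon P i)"

section \<open>Iterates and Nesterov--Todd scaling\<close>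

record iterate =
  itX :: "real mat"
  itS :: "nat \<Rightarrow> real mat"
  itv :: "nat \<Rightarrow> real vec"
  itvb :: "nat \<Rightarrow> real vec"
  itG :: "nat \<Rightarrow> real mat"

definition Xbar :: "coupled_sdp \<Rightarrow> iterate \<Rightarrow> nat \<Rightarrow> real mat" where
  "Xbar P Z i = sub_blk P (itX Z) i"

definition nt_matrix :: "real mat \<Rightarrow> real mat \<Rightarrow> real mat" where
  "nt_matrix X S = msqrt X * minv (msqrt (msqrt X * S * msqrt X)) * msqrt X"

definition is_iterate :: "coupled_sdp \<Rightarrow> iterate \<Rightarrow> bool" where
  "is_iterate P Z \<longleftrightarrow> itX Z \<in> sparse_sym P \<and>
     (\<forall>i < nblk P.
        pos_def (Xbar P Z i) \<and>
        itS Z i \<in> sym_mats (bsize P i) \<and> pos_def (itS Z i) \<and>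
        itv Z i \<in> carrier_vec (ncon P i) \<and>
        itvb Z i \<in> carrier_vec (tri (bsize P i)) \<and>
        itG Z i \<in> carrier_mat (bsize P i) (bsize P i) \<and>
        itG Z i * (itG Z i)\<^sup>T = nt_matrix (Xbar P Z i) (itS Z i)) \<and>
     finsum_vec TYPE(real) (tri (dimX P))
       (\<lambda>i. (E_blk P i \<otimes>\<^sub>s E_blk P i)\<^sup>T *\<^sub>v itvb Z i) {..<nblk P} = 0\<^sub>v (tri (dimX P))"

definition D_nt :: "iterate \<Rightarrow> nat \<Rightarrow> real mat" where
  "D_nt Z i = minv (itG Z i)"

definition U_blk :: "iterate \<Rightarrow> nat \<Rightarrow> real mat" where
  "U_blk Z i = D_nt Z i \<otimes>\<^sub>s ((minv (D_nt Z i))\<^sup>T * itS Z i)"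

definition F_blk :: "coupled_sdp \<Rightarrow> iterate \<Rightarrow> nat \<Rightarrow> real mat" where
  "F_blk P Z i = (D_nt Z i * Xbar P Z i) \<otimes>\<^sub>s ((minv (D_nt Z i))\<^sup>T)"

section \<open>Residuals\<close>

definition mu :: "coupled_sdp \<Rightarrow> iterate \<Rightarrow> real" where
  "mu P Z = (\<Sum>i<nblk P. mat_inner (Xbar P Z i) (itS Z i)) / real (\<Sum>j<nblk P. bsize P j)"

definition r_primal :: "coupled_sdp \<Rightarrow> iterate \<Rightarrow> nat \<Rightarrow> real vec" where
  "r_primal P Z i = rhsb P i - Qcal P i *\<^sub>v svec (Xbar P Z i)"

definition R_dual :: "coupled_sdp \<Rightarrow> iterate \<Rightarrow> nat \<Rightarrow> real mat" where
  "R_dual P Z i = costW P i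
     - mat (bsize P i) (bsize P i) (\<lambda>(a, b). \<Sum>j<ncon P i. itv Z i $ j * conQ P i j $$ (a, b))
     + smat (bsize P i) (itvb Z i) - itS Z i"

definition R_cent :: "coupled_sdp \<Rightarrow> iterate \<Rightarrow> real \<Rightarrow> nat \<Rightarrow> real mat" where
  "R_cent P Z \<sigma> i = (\<sigma> * mu P Z) \<cdot>\<^sub>m 1\<^sub>m (bsize P i)
     - symmetrize (D_nt Z i) (Xbar P Z i * itS Z i)"

definition r_predictor :: "coupled_sdp \<Rightarrow> iterate \<Rightarrow> nat \<Rightarrow> real vec" where
  "r_predictor P Z i = svec (R_dual P Z i) - minv (F_blk P Z i) *\<^sub>v svec (R_cent P Z 0 i)"

definition dS_predictor :: "coupled_sdp \<Rightarrow> iterate \<Rightarrow> real mat \<Rightarrow> nat \<Rightarrow> real mat" where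
  "dS_predictor P Z dXp i = smat (bsize P i)
     (minv (F_blk P Z i) *\<^sub>v (svec (R_cent P Z 0 i) - U_blk Z i *\<^sub>v svec (sub_blk P dXp i)))"

definition r_corrector :: "coupled_sdp \<Rightarrow> iterate \<Rightarrow> real \<Rightarrow> real mat \<Rightarrow> nat \<Rightarrow> real vec" where
  "r_corrector P Z \<sigma> dXp i = svec (R_dual P Z i) - minv (F_blk P Z i) *\<^sub>v
     (svec (R_cent P Z \<sigma> i)
      - svec (symmetrize (D_nt Z i) (sub_blk P dXp i * dS_predictor P Z dXp i)))"

section \<open>The reduced quadratic program\<close>

definition qp_objective ::
  "coupled_sdp \<Rightarrow> iterate \<Rightarrow> (nat \<Rightarrow> real vec) \<Rightarrow> real mat \<Rightarrow> real" where
  "qp_objective P Z r dX = (\<Sum>i<nblk P.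
     1/2 * (svec (sub_blk P dX i) \<bullet>
              ((minv (F_blk P Z i) * U_blk Z i) *\<^sub>v svec (sub_blk P dX i)))
     + r i \<bullet> svec (sub_blk P dX i))"

definition qp_feasible :: "coupled_sdp \<Rightarrow> iterate \<Rightarrow> real mat set" where
  "qp_feasible P Z = {dX \<in> sparse_sym P.
     \<forall>i < nblk P. Qcal P i *\<^sub>v svec (sub_blk P dX i) = r_primal P Z i}"

definition qp_solution ::
  "coupled_sdp \<Rightarrow> iterate \<Rightarrow> (nat \<Rightarrow> real vec) \<Rightarrow> real mat \<Rightarrow> bool" where
  "qp_solution P Z r dX \<longleftrightarrow> dX \<in> qp_feasible P Z \<and>
     (\<forall>dY \<in> qp_feasible P Z. qp_objective P Z r dX \<le> qp_objective P Z r dY)"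

definition admissible_r :: "coupled_sdp \<Rightarrow> iterate \<Rightarrow> (nat \<Rightarrow> real vec) \<Rightarrow> bool" where
  "admissible_r P Z r \<longleftrightarrow> r = r_predictor P Z \<or>
     (\<exists>\<sigma> \<in> {0..1}. \<exists>dXp. qp_solution P Z (r_predictor P Z) dXp \<and> r = r_corrector P Z \<sigma> dXp)"

section \<open>Assembled quantities\<close>

definition Q_big :: "coupled_sdp \<Rightarrow> real mat" where
  "Q_big P = diag_block_mat (map (Qcal P) [0..<nblk P])"

definition U_big :: "coupled_sdp \<Rightarrow> iterate \<Rightarrow> real mat" where
  "U_big P Z = diag_block_mat (map (U_blk Z) [0..<nblk P])"

definition F_big :: "coupled_sdp \<Rightarrow> iterate \<Rightarrow> real mat" where
  "F_big P Z = diag_block_mat (map (F_blk P Z) [0..<nblk P])"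

definition E_big :: "coupled_sdp \<Rightarrow> real mat" where
  "E_big P = stack_rows (tri (dimX P)) (map (\<lambda>i. E_blk P i \<otimes>\<^sub>s E_blk P i) [0..<nblk P])"

definition stack :: "coupled_sdp \<Rightarrow> (nat \<Rightarrow> real vec) \<Rightarrow> real vec" where
  "stack P f = stack_vec (map f [0..<nblk P])"

(* Optimality conditions for the Lagrangian
   objective - (\<Sum>i. dv i \<bullet> (Qcal P i *\<^sub>v dx i - r_primal P Z i)). *)
definition dual_multipliers ::
  "coupled_sdp \<Rightarrow> iterate \<Rightarrow> (nat \<Rightarrow> real vec) \<Rightarrow> real mat \<Rightarrow> (nat \<Rightarrow> real vec) \<Rightarrow> bool" where
  "dual_multipliers P Z r dX dv \<longleftrightarrow>
     (\<forall>i < nblk P. dv i \<in> carrier_vec (ncon P i)) \<and>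
     (E_big P)\<^sup>T *\<^sub>v ((minv (F_big P Z) * U_big P Z * E_big P) *\<^sub>v svec dX
                      - (Q_big P)\<^sup>T *\<^sub>v stack P dv)
       = - ((E_big P)\<^sup>T *\<^sub>v stack P r) \<and>
     (Q_big P * E_big P) *\<^sub>v svec dX = stack P (r_primal P Z)"

definition newton_matrix :: "coupled_sdp \<Rightarrow> iterate \<Rightarrow> real mat" where
  "newton_matrix P Z =
    (let M = (\<Sum>i<nblk P. tri (bsize P i));
         t = tri (dimX P);
         p = (\<Sum>i<nblk P. ncon P i)
     in four_block_mat
          (four_block_mat (- (minv (F_big P Z) * U_big P Z)) (0\<^sub>m M t)
                          (0\<^sub>m t M)                          (0\<^sub>m t t))
          (four_block_mat ((Q_big P)\<^sup>T) (1\<^sub>m M)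
                          (0\<^sub>m t p)    (- ((E_big P)\<^sup>T)))
          (four_block_mat (Q_big P)  (0\<^sub>m p t)
                          (1\<^sub>m M)    (- E_big P))
          (four_block_mat (0\<^sub>m p p) (0\<^sub>m p M)
                          (0\<^sub>m M p) (0\<^sub>m M M)))"

end

theory Submission
  imports Defs
    "Jordan_Normal_Form.Char_Poly"
    "HOL-Computational_Algebra.Fundamental_Theorem_Algebra"
begin

text \<open>Given that every \<open>F\<^sup>i\<close> is invertible, the four block rows of the system are read off: the first
  is the definition of \<open>\<Delta>v\<^sup>i\<close> (barred), the second is stationarity, the third is feasibility, and the
  fourth is the identity \<open>svec(X\<^sub>J\<^sub>J) = (E\<^sub>J \<otimes>\<^sub>s E\<^sub>J) svec X\<close>.

  Invertibility of \<open>F\<^sup>i\<close> is a Sylvester argument: in scaled variables its kernel equation is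
  \<open>Y K + K Y = 0\<close> with \<open>Y\<close> positive definite, which forces \<open>K = 0\<close>. It requires the scaling matrix
  \<open>D\<^sup>i\<close> to be invertible, and hence that the square roots inside the Nesterov--Todd matrix exist and
  are unique. They exist by deflating along an eigenvector, and are unique by the same Sylvester
  argument, since \<open>B\<^sup>2 = B'\<^sup>2\<close> gives \<open>B (B - B') + (B - B') B' = 0\<close>.\<close>

section \<open>Positive definite matrices and their square roots\<close>

lemma real_scalar_prod_self_pos:
  fixes v :: "real vec"
  assumes "v \<in> carrier_vec n" "v \<noteq> 0\<^sub>v n"
  shows "v \<bullet> v > 0"
proof -
  obtain k where k: "k < n" "v $ k \<noteq> 0"
    using assms by (metis carrier_vecD eq_vecI index_zero_vec)
  have "v \<bullet> v = (\<Sum>i<n. (v $ i)\<^sup>2)"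
    using assms by (simp add: scalar_prod_def power2_eq_square lessThan_atLeast0)
  also have "\<dots> > 0"
    by (rule sum_pos2[of _ k]) (use k in auto)
  finally show ?thesis .
qed

lemma scalar_prod_mult_mat_vec_transpose:
  fixes A :: "real mat"
  assumes "A \<in> carrier_mat m n" "x \<in> carrier_vec m" "y \<in> carrier_vec n"
  shows "x \<bullet> (A *\<^sub>v y) = (A\<^sup>T *\<^sub>v x) \<bullet> y"
  using transpose_vec_mult_scalar[OF assms(1,3,2)] by simp

text \<open>If \<open>a + \<i> b\<close> is a complex eigenvector to \<open>\<alpha> + \<i> \<beta>\<close>, then comparing \<open>a \<bullet> A b\<close> with
  \<open>b \<bullet> A a\<close> gives \<open>\<beta> (|a|\<^sup>2 + |b|\<^sup>2) = 0\<close>, so \<open>a\<close> and \<open>b\<close> solve the real eigenvalue equation.\<close>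
lemma real_symmetric_eigenvector:
  fixes A :: "real mat"
  assumes A: "A \<in> carrier_mat n n" and sym: "A\<^sup>T = A" and n: "n > 0"
  obtains e v where "v \<in> carrier_vec n" "v \<noteq> 0\<^sub>v n" "A *\<^sub>v v = e \<cdot>\<^sub>v v"
proof -
  \<comment> \<open>Passing to complex entries guarantees a root of the characteristic
    polynomial.\<close>
  define C where "C = map_mat complex_of_real A"
  have C: "C \<in> carrier_mat n n" using A by (auto simp: C_def)
  have "degree (char_poly C) = n" using degree_monic_char_poly[OF C] by simp
  hence "\<not> constant (poly (char_poly C))" using n by (simp add: constant_degree)
  then obtain z where "poly (char_poly C) z = 0" using fundamental_theorem_of_algebra by blast
  hence "eigenvalue C z" using eigenvalue_root_char_poly[OF C] by simp
  then obtain w where w: "w \<in> carrier_vec n" "w \<noteq> 0\<^sub>v n" "C *\<^sub>v w = z \<cdot>\<^sub>v w"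
    using C unfolding eigenvalue_def eigenvector_def by auto
  define a where "a = map_vec Re w"
  define b where "b = map_vec Im w"
  have a: "a \<in> carrier_vec n" and b: "b \<in> carrier_vec n" using w by (auto simp: a_def b_def)
  \<comment> \<open>The entries of \<open>A\<close> are real, so the real and imaginary parts of
    these row equations are the two equations \<open>Aa\<close> and \<open>Ab\<close>.\<close>
  have row: "(\<Sum>j<n. complex_of_real (A $$ (i,j)) * w $ j) = z * w $ i" if "i < n" for i
  proof -
    have "(C *\<^sub>v w) $ i = (z \<cdot>\<^sub>v w) $ i" using w by simp
    thus ?thesis using that w(1) A
      by (simp add: C_def mult_mat_vec_def scalar_prod_def lessThan_atLeast0)
  qed
  have Aa: "A *\<^sub>v a = Re z \<cdot>\<^sub>v a - Im z \<cdot>\<^sub>v b"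
  proof (rule eq_vecI)
    fix i assume "i < dim_vec (Re z \<cdot>\<^sub>v a - Im z \<cdot>\<^sub>v b)"
    hence i: "i < n" using b by simp
    show "(A *\<^sub>v a) $ i = (Re z \<cdot>\<^sub>v a - Im z \<cdot>\<^sub>v b) $ i"
      using arg_cong[OF row[OF i], of Re] i A w(1)
      by (simp add: a_def b_def mult_mat_vec_def scalar_prod_def lessThan_atLeast0)
  qed (use A b in auto)
  have Ab: "A *\<^sub>v b = Im z \<cdot>\<^sub>v a + Re z \<cdot>\<^sub>v b"
  proof (rule eq_vecI)
    fix i assume "i < dim_vec (Im z \<cdot>\<^sub>v a + Re z \<cdot>\<^sub>v b)"
    hence i: "i < n" using b by simp
    show "(A *\<^sub>v b) $ i = (Im z \<cdot>\<^sub>v a + Re z \<cdot>\<^sub>v b) $ i"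
      using arg_cong[OF row[OF i], of Im] i A w(1)
      by (simp add: a_def b_def mult_mat_vec_def scalar_prod_def lessThan_atLeast0)
  qed (use A b in auto)
  have "b \<bullet> (A *\<^sub>v a) = (A *\<^sub>v b) \<bullet> a"
    using scalar_prod_mult_mat_vec_transpose[OF A b a] sym by simp
  moreover have "b \<bullet> (A *\<^sub>v a) = Re z * (b \<bullet> a) - Im z * (b \<bullet> b)"
    unfolding Aa using a b by (simp add: scalar_prod_minus_distrib[of _ n])
  moreover have "(A *\<^sub>v b) \<bullet> a = Im z * (a \<bullet> a) + Re z * (b \<bullet> a)"
    unfolding Ab using a b by (simp add: add_scalar_prod_distrib[of _ n])
  ultimately have im: "Im z * (a \<bullet> a + b \<bullet> b) = 0" by (simp add: algebra_simps)
  have "a \<noteq> 0\<^sub>v n \<or> b \<noteq> 0\<^sub>v n"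
  proof (rule ccontr)
    assume "\<not> ?thesis"
    hence *: "a = 0\<^sub>v n" "b = 0\<^sub>v n" by auto
    have "w $ i = 0" if "i < n" for i
    proof -
      have "a $ i = 0" "b $ i = 0" using * that by auto
      thus ?thesis using that w(1) by (auto simp: a_def b_def complex_eq_iff)
    qed
    thus False using w by (metis carrier_vecD eq_vecI index_zero_vec)
  qed
  moreover have nn: "a \<bullet> a \<ge> 0" "b \<bullet> b \<ge> 0" by (auto simp: scalar_prod_def intro: sum_nonneg)
  ultimately have "a \<bullet> a + b \<bullet> b > 0"
    using real_scalar_prod_self_pos[OF a] real_scalar_prod_self_pos[OF b] by fastforce
  hence "Im z = 0" using im by simp
  hence "A *\<^sub>v a = Re z \<cdot>\<^sub>v a" "A *\<^sub>v b = Re z \<cdot>\<^sub>v b"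
    using Aa Ab a b by auto
  thus ?thesis using that a b \<open>a \<noteq> 0\<^sub>v n \<or> b \<noteq> 0\<^sub>v n\<close> by blast
qed

text \<open>The reflection in the hyperplane orthogonal to \<open>v - e\<^sub>0\<close> swaps \<open>v\<close> and \<open>e\<^sub>0\<close>.\<close>
lemma householder_exists:
  fixes v :: "real vec"
  assumes v: "v \<in> carrier_vec n" and unit: "v \<bullet> v = 1" and n: "n > 0"
  obtains W where "W \<in> carrier_mat n n" "W\<^sup>T = W" "W * W = 1\<^sub>m n"
    "W *\<^sub>v unit_vec n 0 = v" "W *\<^sub>v v = unit_vec n 0"
proof (cases "v = unit_vec n 0")
  \<comment> \<open>Here \<open>v - unit_vec n 0\<close> vanishes and gives no normal vector, so the
    identity serves as \<open>W\<close>.\<close>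
  case True
  thus ?thesis using that[of "1\<^sub>m n"] by auto
next
  case False
  define u where "u = v - unit_vec n 0"
  have u: "u \<in> carrier_vec n" using v by (simp add: u_def)
  have "u \<noteq> 0\<^sub>v n"
  proof
    assume "u = 0\<^sub>v n"
    hence "u $ i = 0" if "i < n" for i using that by simp
    hence "v $ i = unit_vec n 0 $ i" if "i < n" for i
      using that v by (fastforce simp: u_def)
    thus False using False v by (metis carrier_vecD eq_vecI unit_vec_carrier)
  qed
  hence uu: "u \<bullet> u > 0" using real_scalar_prod_self_pos[OF u] by simp
  \<comment> \<open>The Householder matrix of \<open>u\<close>; the division by
    \<open>u \<bullet> u\<close> accounts for the length of \<open>u\<close>.\<close>
  define W where "W = mat n n (\<lambda>(i,j). (if i = j then 1 else 0) - 2 / (u \<bullet> u) * u $ i * u $ j)"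
  have W: "W \<in> carrier_mat n n" by (simp add: W_def)
  have Wx: "W *\<^sub>v x = x - (2 / (u \<bullet> u) * (u \<bullet> x)) \<cdot>\<^sub>v u" if x: "x \<in> carrier_vec n" for x
  proof (rule eq_vecI)
    fix i assume "i < dim_vec (x - (2 / (u \<bullet> u) * (u \<bullet> x)) \<cdot>\<^sub>v u)"
    hence i: "i < n" using u by simp
    have "(W *\<^sub>v x) $ i = (\<Sum>j<n. ((if i = j then 1 else 0) - 2 / (u \<bullet> u) * u $ i * u $ j) * x $ j)"
      using i x by (simp add: W_def mult_mat_vec_def scalar_prod_def lessThan_atLeast0)
    also have "\<dots> = (\<Sum>j<n. if i = j then x $ j else 0) - (\<Sum>j<n. 2 / (u \<bullet> u) * u $ i * (u $ j * x $ j))"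
      unfolding sum_subtractf[symmetric] by (rule sum.cong) (auto simp: algebra_simps)
    also have "\<dots> = x $ i - 2 / (u \<bullet> u) * u $ i * (u \<bullet> x)"
      using i x by (simp add: sum_distrib_left scalar_prod_def lessThan_atLeast0)
    finally show "(W *\<^sub>v x) $ i = (x - (2 / (u \<bullet> u) * (u \<bullet> x)) \<cdot>\<^sub>v u) $ i"
      using i x u by simp
  qed (use W u x in auto)
  have WW: "W *\<^sub>v (W *\<^sub>v x) = x" if x: "x \<in> carrier_vec n" for x
  proof -
    define c where "c = 2 / (u \<bullet> u) * (u \<bullet> x)"
    \<comment> \<open>The reflection negates the component along \<open>u\<close>, so a second
      application restores what the first subtracted.\<close>
    have "u \<bullet> (W *\<^sub>v x) = - (u \<bullet> x)"
      unfolding Wx[OF x] using x u uu by (simp add: scalar_prod_minus_distrib[of _ n])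
    hence "W *\<^sub>v (W *\<^sub>v x) = (W *\<^sub>v x) - (- c) \<cdot>\<^sub>v u"
      using Wx[of "W *\<^sub>v x"] W x by (simp add: c_def)
    thus ?thesis unfolding Wx[OF x] c_def[symmetric] using x u by auto
  qed
  have vec0: "v \<bullet> unit_vec n 0 = v $ 0" "unit_vec n 0 \<bullet> v = v $ 0"
    "unit_vec n 0 \<bullet> unit_vec n 0 = (1::real)"
    using v n by (auto simp: scalar_prod_left_unit scalar_prod_right_unit)
  \<comment> \<open>Unit length of \<open>v\<close> makes the coefficient in \<open>Wx\<close> equal
    to -1 at \<open>unit_vec n 0\<close>, which is therefore sent to
    \<open>unit_vec n 0 + u = v\<close>.\<close>
  have "u \<bullet> u = 2 - 2 * v $ 0" "u \<bullet> unit_vec n 0 = v $ 0 - 1"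
    unfolding u_def using v n unit vec0
    by (auto simp: scalar_prod_minus_distrib[of _ n] minus_scalar_prod_distrib[of _ n])
  hence "2 / (u \<bullet> u) * (u \<bullet> unit_vec n 0) = - 1" using uu by (simp add: field_simps)
  hence W0: "W *\<^sub>v unit_vec n 0 = v" using Wx[of "unit_vec n 0"] v
    by (auto simp: u_def)
  have "W * W = 1\<^sub>m n"
  proof (rule eq_matI)
    fix i j assume "i < dim_row (1\<^sub>m n :: real mat)" "j < dim_col (1\<^sub>m n :: real mat)"
    hence ij: "i < n" "j < n" by auto
    have "(W * W) *\<^sub>v unit_vec n j = unit_vec n j"
      using WW[of "unit_vec n j"] W by (subst assoc_mult_mat_vec[of _ n n]) auto
    hence "((W * W) *\<^sub>v unit_vec n j) $ i = unit_vec n j $ i" by simp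
    thus "(W * W) $$ (i,j) = 1\<^sub>m n $$ (i,j)"
      using ij W by (simp add: scalar_prod_right_unit del: assoc_mult_mat_vec)
  qed (use W in auto)
  moreover have "W\<^sup>T = W" by (rule eq_matI) (auto simp: W_def)
  moreover have "W *\<^sub>v v = unit_vec n 0" using WW[of "unit_vec n 0"] W0 by simp
  ultimately show ?thesis using that[OF W] W0 by blast
qed

section \<open>Trivial kernels and inverses\<close>

lemma det_nonzero_iff_trivial_kernel:
  fixes A :: "real mat"
  assumes "A \<in> carrier_mat n n"
  shows "det A \<noteq> 0 \<longleftrightarrow> (\<forall>x \<in> carrier_vec n. A *\<^sub>v x = 0\<^sub>v n \<longrightarrow> x = 0\<^sub>v n)"
  using det_0_iff_vec_prod_zero_field[OF assms] by blast

text \<open>A nonzero determinant makes \<open>A\<close> a unit of the matrix ring, so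
  \<open>mat_inverse\<close> does not return \<open>None\<close> and \<open>the\<close> in
  \<open>minv\<close> picks a genuine inverse.\<close>

lemma minv_inverse:
  assumes A: "A \<in> carrier_mat n n" and det: "det A \<noteq> 0"
  shows "minv A \<in> carrier_mat n n" "A * minv A = 1\<^sub>m n" "minv A * A = 1\<^sub>m n"
proof -
  have "mat_inverse A \<noteq> None"
    using mat_inverse(1)[OF A, of "()"] det_non_zero_imp_unit[OF A det, of "()"] by blast
  then obtain B where "mat_inverse A = Some B" by blast
  thus "minv A \<in> carrier_mat n n" "A * minv A = 1\<^sub>m n" "minv A * A = 1\<^sub>m n"
    using mat_inverse(2)[OF A] by (auto simp: minv_def)
qed

lemma det_minv:
  assumes A: "A \<in> carrier_mat n n" and det: "det A \<noteq> 0"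
  shows "det (minv A) \<noteq> 0"
  using minv_inverse[OF A det] det_mult[OF A minv_inverse(1)[OF A det]] by auto

section \<open>Positive definiteness, congruence and the Sylvester equation\<close>

lemma pos_defI:
  assumes "A \<in> carrier_mat n n" "A\<^sup>T = A"
    and "\<And>x. x \<in> carrier_vec n \<Longrightarrow> x \<noteq> 0\<^sub>v n \<Longrightarrow> x \<bullet> (A *\<^sub>v x) > 0"
  shows "pos_def A"
  using assms by (auto simp: pos_def_def sym_mats_def)

lemma pos_defD:
  assumes "pos_def A" "A \<in> carrier_mat n n"
  shows "A\<^sup>T = A" "\<And>x. x \<in> carrier_vec n \<Longrightarrow> x \<noteq> 0\<^sub>v n \<Longrightarrow> x \<bullet> (A *\<^sub>v x) > 0"
  using assms by (auto simp: pos_def_def sym_mats_def)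

lemma pos_semidefD:
  assumes "pos_semidef A" "A \<in> carrier_mat n n"
  shows "A\<^sup>T = A" "\<And>x. x \<in> carrier_vec n \<Longrightarrow> x \<bullet> (A *\<^sub>v x) \<ge> 0"
  using assms by (auto simp: pos_semidef_def sym_mats_def)

lemma pos_def_nonneg:
  assumes "pos_def A" "A \<in> carrier_mat n n" "x \<in> carrier_vec n"
  shows "x \<bullet> (A *\<^sub>v x) \<ge> 0"
  using pos_defD(2)[OF assms] assms by (cases "x = 0\<^sub>v n") auto

lemma pos_def_imp_pos_semidef:
  assumes "pos_def A"
  shows "pos_semidef A"
proof -
  have sym: "A \<in> sym_mats (dim_row A)" using assms by (simp add: pos_def_def)
  hence "A \<in> carrier_mat (dim_row A) (dim_row A)" by (simp add: sym_mats_def)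
  thus ?thesis unfolding pos_semidef_def using sym pos_def_nonneg[OF assms] by blast
qed

lemma pos_def_det_nonzero:
  assumes pd: "pos_def A" and A: "A \<in> carrier_mat n n"
  shows "det A \<noteq> 0"
  unfolding det_nonzero_iff_trivial_kernel[OF A]
proof (intro ballI impI, rule ccontr)
  fix x assume x: "x \<in> carrier_vec n" "A *\<^sub>v x = 0\<^sub>v n" "x \<noteq> 0\<^sub>v n"
  thus False using pos_defD(2)[OF pd A x(1,3)] by simp
qed

text \<open>The form at \<open>x\<close> is the form of \<open>A\<close> at \<open>W x\<close>,
  which is nonzero because \<open>W\<close> is injective. This serves for reflections, square roots
  and scalings alike.\<close>

lemma pos_def_congruence:
  assumes pd: "pos_def A" and A: "A \<in> carrier_mat n n"
    and W: "W \<in> carrier_mat n n" and det: "det W \<noteq> 0"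
  shows "pos_def (W\<^sup>T * A * W)"
proof (rule pos_defI[of _ n])
  show "W\<^sup>T * A * W \<in> carrier_mat n n" using A W by simp
  show "(W\<^sup>T * A * W)\<^sup>T = W\<^sup>T * A * W"
    using A W pos_defD(1)[OF pd A] by (simp add: transpose_mult[of _ n n _ n] assoc_mult_mat[of _ n n _ n _ n])
  fix x :: "real vec" assume x: "x \<in> carrier_vec n" "x \<noteq> 0\<^sub>v n"
  have Wx: "W *\<^sub>v x \<in> carrier_vec n" "W *\<^sub>v x \<noteq> 0\<^sub>v n"
    using x W det det_nonzero_iff_trivial_kernel[OF W] by auto
  have "x \<bullet> ((W\<^sup>T * A * W) *\<^sub>v x) = x \<bullet> (W\<^sup>T *\<^sub>v (A *\<^sub>v (W *\<^sub>v x)))"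
    using A W x by (simp add: assoc_mult_mat_vec[of _ n n _ n])
  also have "\<dots> = (W *\<^sub>v x) \<bullet> (A *\<^sub>v (W *\<^sub>v x))"
    using scalar_prod_mult_mat_vec_transpose[of "W\<^sup>T" n n x "A *\<^sub>v (W *\<^sub>v x)"] A W x Wx by simp
  finally show "x \<bullet> ((W\<^sup>T * A * W) *\<^sub>v x) > 0" using pos_defD(2)[OF pd A Wx] by simp
qed

text \<open>Pairing \<open>M E + E N = 0\<close> entrywise with \<open>E\<close> expresses \<open>0\<close> as the sum of the values of
  the forms \<open>M\<close> at the columns and \<open>N\<close> at the rows of \<open>E\<close>.\<close>
lemma sylvester_zero:
  assumes M: "M \<in> carrier_mat n n" "pos_def M"
    and N: "N \<in> carrier_mat n n" "pos_semidef N"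
    and E: "E \<in> carrier_mat n n" and eq: "M * E + E * N = 0\<^sub>m n n"
  shows "E = 0\<^sub>m n n"
proof -
  have NT: "N\<^sup>T = N" using pos_semidefD(1)[OF N(2,1)] .
  have c: "(\<Sum>i<n. E $$ (i,j) * (M * E) $$ (i,j)) = col E j \<bullet> (M *\<^sub>v col E j)" if "j < n" for j
    using M E that by (simp add: scalar_prod_def lessThan_atLeast0)
  have r: "(\<Sum>j<n. E $$ (i,j) * (E * N) $$ (i,j)) = row E i \<bullet> (N *\<^sub>v row E i)" if i: "i < n" for i
  proof -
    have "(E * N) $$ (i,j) = (N *\<^sub>v row E i) $ j" if j: "j < n" for j
    proof -
      have "(E * N) $$ (i,j) = row E i \<bullet> col N j" using i j E N by simp
      also have "col N j = row N j" using NT j N by (metis carrier_matD(2) row_transpose)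
      also have "row E i \<bullet> row N j = row N j \<bullet> row E i"
        using i j E N by (intro comm_scalar_prod[of _ n]) auto
      finally show ?thesis using j N by simp
    qed
    thus ?thesis using i E N by (simp add: scalar_prod_def[of "row E i" "N *\<^sub>v row E i"] lessThan_atLeast0)
  qed
  have "0 = (\<Sum>i<n. \<Sum>j<n. E $$ (i,j) * ((M * E) $$ (i,j) + (E * N) $$ (i,j)))"
  proof -
    have "(M * E) $$ (i,j) + (E * N) $$ (i,j) = 0" if "i < n" "j < n" for i j
      using arg_cong[OF eq, of "\<lambda>X. X $$ (i,j)"] that M E N by simp
    thus ?thesis by simp
  qed
  also have "\<dots> = (\<Sum>i<n. \<Sum>j<n. E $$ (i,j) * (M * E) $$ (i,j)) + (\<Sum>i<n. \<Sum>j<n. E $$ (i,j) * (E * N) $$ (i,j))"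
    by (simp add: sum.distrib distrib_left)
  also have "(\<Sum>i<n. \<Sum>j<n. E $$ (i,j) * (M * E) $$ (i,j)) = (\<Sum>j<n. col E j \<bullet> (M *\<^sub>v col E j))"
    by (subst sum.swap) (simp add: c)
  also have "(\<Sum>i<n. \<Sum>j<n. E $$ (i,j) * (E * N) $$ (i,j)) = (\<Sum>i<n. row E i \<bullet> (N *\<^sub>v row E i))"
    by (simp add: r)
  finally have *: "0 = (\<Sum>j<n. col E j \<bullet> (M *\<^sub>v col E j)) + (\<Sum>i<n. row E i \<bullet> (N *\<^sub>v row E i))" .
  have "(\<Sum>i<n. row E i \<bullet> (N *\<^sub>v row E i)) \<ge> 0"
    using E N by (intro sum_nonneg pos_semidefD(2)[OF N(2,1)]) auto
  moreover have nn: "col E j \<bullet> (M *\<^sub>v col E j) \<ge> 0" if "j < n" for j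
    using pos_def_nonneg[OF M(2,1), of "col E j"] E that by auto
  moreover have "(\<Sum>j<n. col E j \<bullet> (M *\<^sub>v col E j)) \<ge> 0" by (intro sum_nonneg nn) auto
  \<comment> \<open>Two nonnegative sums with total zero both vanish; definiteness of
    \<open>M\<close> then makes every column of \<open>E\<close> zero.\<close>
  ultimately have "(\<Sum>j<n. col E j \<bullet> (M *\<^sub>v col E j)) = 0" using * by linarith
  hence z: "col E j \<bullet> (M *\<^sub>v col E j) = 0" if "j < n" for j
    using that nn by (subst (asm) sum_nonneg_eq_0_iff) auto
  have "col E j = 0\<^sub>v n" if "j < n" for j
    using z[OF that] pos_defD(2)[OF M(2,1), of "col E j"] E that by fastforce
  hence "E $$ (i,j) = 0" if "i < n" "j < n" for i j
    using that E by (metis carrier_matD index_col index_zero_vec(1))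
  thus ?thesis using E by (intro eq_matI) auto
qed

section \<open>Square roots of positive definite matrices\<close>

text \<open>Induction on the size: a reflection taking the first unit vector to a unit eigenvector
  turns \<open>A\<close> into a block matrix with diagonal \<open>e\<close> and \<open>A'\<close>.
  The root is built from \<open>sqrt e\<close> and a root of \<open>A'\<close>, and reflected
  back.\<close>

lemma pos_def_sqrt_exists:
  assumes "A \<in> carrier_mat n n" "pos_def A"
  shows "\<exists>B \<in> carrier_mat n n. pos_def B \<and> B * B = A"
  using assms
proof (induction n arbitrary: A)
  case 0
  \<comment> \<open>All 0 by 0 matrices are equal, so \<open>A\<close> is its own root.\<close>
  thus ?case by (intro bexI[of _ A]) (auto intro!: eq_matI)
next
  case (Suc n)
  let ?n = "Suc n"
  note A = Suc.prems(1) and pd = Suc.prems(2)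
  note AT = pos_defD(1)[OF pd A]
  obtain e w where w: "w \<in> carrier_vec ?n" "w \<noteq> 0\<^sub>v ?n" "A *\<^sub>v w = e \<cdot>\<^sub>v w"
    using real_symmetric_eigenvector[OF A AT] by blast
  have ww: "w \<bullet> w > 0" using real_scalar_prod_self_pos w by blast
  \<comment> \<open>Pairing the eigenvalue equation with \<open>w\<close> shows that
    \<open>e\<close> is positive, so that \<open>sqrt e\<close> is positive and squares to
    \<open>e\<close>.\<close>
  have "e * (w \<bullet> w) > 0" using pos_defD(2)[OF pd A w(1,2)] w by simp
  hence e: "e > 0" using ww by (simp add: zero_less_mult_iff)
  define v where "v = (1 / sqrt (w \<bullet> w)) \<cdot>\<^sub>v w"
  have v: "v \<in> carrier_vec ?n" using w by (simp add: v_def)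
  have Av: "A *\<^sub>v v = e \<cdot>\<^sub>v v"
    unfolding v_def using A w by (simp add: mult_mat_vec smult_smult_assoc mult.commute)
  have "v \<bullet> v = 1" unfolding v_def using w ww by simp
  then obtain W where W: "W \<in> carrier_mat ?n ?n" "W\<^sup>T = W" "W * W = 1\<^sub>m ?n"
    "W *\<^sub>v unit_vec ?n 0 = v" "W *\<^sub>v v = unit_vec ?n 0"
    using householder_exists[OF v] by blast
  have detW: "det W \<noteq> 0" using det_mult[OF W(1,1)] W(3) by auto
  define C where "C = W * A * W"
  have C: "C \<in> carrier_mat ?n ?n" using A W by (simp add: C_def)
  have pdC: "pos_def C" using pos_def_congruence[OF pd A W(1) detW] W(2) by (simp add: C_def)
  note CT = pos_defD(1)[OF pdC C]
  have Ce: "C *\<^sub>v unit_vec ?n 0 = e \<cdot>\<^sub>v unit_vec ?n 0"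
    unfolding C_def using A W v Av by (simp add: assoc_mult_mat_vec[of _ ?n ?n _ ?n] mult_mat_vec[of _ ?n ?n])
  \<comment> \<open>The first unit vector is an eigenvector of \<open>C\<close>, which fixes the
    first column; symmetry then fixes the first row.\<close>
  have C0: "C $$ (i,0) = (if i = 0 then e else 0)" if "i < ?n" for i
  proof -
    have "C $$ (i,0) = (C *\<^sub>v unit_vec ?n 0) $ i" using that C by (simp add: scalar_prod_right_unit)
    also have "\<dots> = (if i = 0 then e else 0)" unfolding Ce using that by simp
    finally show ?thesis .
  qed
  have C0': "C $$ (0,i) = (if i = 0 then e else 0)" if "i < ?n" for i
  proof -
    have "C $$ (0,i) = C\<^sup>T $$ (i,0)" using that C by simp
    thus ?thesis unfolding CT C0[OF that] .
  qed
  define A' where "A' = mat n n (\<lambda>(i,j). C $$ (Suc i, Suc j))"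
  have A': "A' \<in> carrier_mat n n" by (simp add: A'_def)
  \<comment> \<open>The direct sum of the scalar \<open>c\<close> and \<open>X\<close>. Both
    \<open>C\<close> and its root \<open>B0\<close> have this shape, so \<open>form\<close> serves
    for the definiteness of \<open>A'\<close> and of \<open>B0\<close>.\<close>
  define blk where "blk c X = four_block_mat (mat 1 1 (\<lambda>_. c)) (0\<^sub>m 1 n) (0\<^sub>m n 1) X"
    for c :: real and X
  have m1: "mat 1 1 (\<lambda>_. c) \<in> carrier_mat 1 1" for c :: real by simp
  have blk: "blk c X \<in> carrier_mat ?n ?n" if "X \<in> carrier_mat n n" for c X
    using that by (simp add: blk_def four_block_carrier_mat[of _ 1 1, simplified])
  have CB: "C = blk e A'"
    by (rule eq_matI) (use C C0 C0' in \<open>auto simp: blk_def A'_def\<close>)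
  have form: "(a @\<^sub>v d) \<bullet> (blk c X *\<^sub>v (a @\<^sub>v d)) = c * (a $ 0)\<^sup>2 + d \<bullet> (X *\<^sub>v d)"
    if "a \<in> carrier_vec 1" "d \<in> carrier_vec n" "X \<in> carrier_mat n n" for a d c X
  proof -
    have "blk c X *\<^sub>v (a @\<^sub>v d) = mat 1 1 (\<lambda>_. c) *\<^sub>v a @\<^sub>v X *\<^sub>v d"
      unfolding blk_def using mult_mat_vec_split[OF m1 that(3,1,2)] .
    hence "(a @\<^sub>v d) \<bullet> (blk c X *\<^sub>v (a @\<^sub>v d)) = a \<bullet> (mat 1 1 (\<lambda>_. c) *\<^sub>v a) + d \<bullet> (X *\<^sub>v d)"
      using scalar_prod_append[OF that(1,2) mult_mat_vec_carrier[OF m1[of c] that(1)]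
          mult_mat_vec_carrier[OF that(3,2)]] by simp
    also have "a \<bullet> (mat 1 1 (\<lambda>_. c) *\<^sub>v a) = c * (a $ 0)\<^sup>2"
      using that by (simp add: scalar_prod_def power2_eq_square)
    finally show ?thesis .
  qed
  have "pos_def A'"
  proof (rule pos_defI[OF A'])
    show "A'\<^sup>T = A'"
    proof (rule eq_matI)
      fix i j assume "i < dim_row A'" "j < dim_col A'"
      hence "C\<^sup>T $$ (Suc i, Suc j) = C $$ (Suc j, Suc i)" using C A' by auto
      thus "A'\<^sup>T $$ (i,j) = A' $$ (i,j)"
        using CT \<open>i < dim_row A'\<close> \<open>j < dim_col A'\<close> by (simp add: A'_def)
    qed (use A' in auto)
    fix x :: "real vec" assume x: "x \<in> carrier_vec n" "x \<noteq> 0\<^sub>v n"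
    \<comment> \<open>Padding \<open>x\<close> with a leading zero makes the form of
      \<open>C\<close> agree with that of \<open>A'\<close>.\<close>
    have "0\<^sub>v 1 @\<^sub>v x \<noteq> 0\<^sub>v ?n"
    proof
      assume *: "0\<^sub>v 1 @\<^sub>v x = 0\<^sub>v ?n"
      have "x $ i = 0" if "i < n" for i
        using arg_cong[OF *, of "\<lambda>y. y $ Suc i"] that x by simp
      thus False using x by (metis carrier_vecD eq_vecI index_zero_vec)
    qed
    thus "x \<bullet> (A' *\<^sub>v x) > 0"
      using pos_defD(2)[OF pdC C, of "0\<^sub>v 1 @\<^sub>v x"] form[of "0\<^sub>v 1" x A' e] x A'
      by (simp add: CB append_carrier_vec[of _ 1 _ n, simplified])
  qed
  then obtain B' where B': "B' \<in> carrier_mat n n" "pos_def B'" "B' * B' = A'"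
    using Suc.IH[OF A'] by blast
  define B0 where "B0 = blk (sqrt e) B'"
  have B0: "B0 \<in> carrier_mat ?n ?n" using blk[OF B'(1)] by (simp add: B0_def)
  have "B0 * B0 = four_block_mat (mat 1 1 (\<lambda>_. sqrt e) * mat 1 1 (\<lambda>_. sqrt e)) (0\<^sub>m 1 n) (0\<^sub>m n 1) (B' * B')"
    unfolding B0_def blk_def using B'(1)
    by (subst mult_four_block_mat[of _ 1 1 _ n _ n _ _ 1 _ n]) auto
  also have "mat 1 1 (\<lambda>_. sqrt e) * mat 1 1 (\<lambda>_. sqrt e) = mat 1 1 (\<lambda>_. e)"
    by (rule eq_matI) (use e in \<open>auto simp: scalar_prod_def\<close>)
  finally have BB: "B0 * B0 = C" using B' by (simp add: CB blk_def)
  have pdB0: "pos_def B0"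
  proof (rule pos_defI[OF B0])
    show "B0\<^sup>T = B0"
    proof -
      have "(mat 1 1 (\<lambda>_. sqrt e))\<^sup>T = mat 1 1 (\<lambda>_. sqrt e)" by (rule eq_matI) auto
      thus ?thesis
        unfolding B0_def blk_def using B'(1) pos_defD(1)[OF B'(2,1)]
        by (subst transpose_four_block_mat[of _ 1 1 _ n _ n]) simp_all
    qed
    fix y :: "real vec" assume y: "y \<in> carrier_vec ?n" "y \<noteq> 0\<^sub>v ?n"
    define a where "a = vec_first y 1"
    define d where "d = vec_last y n"
    have ad: "a \<in> carrier_vec 1" "d \<in> carrier_vec n" "y = a @\<^sub>v d"
      using y vec_first_last_append[of y 1 n] by (auto simp: a_def d_def)
    have "a $ 0 \<noteq> 0 \<or> d \<noteq> 0\<^sub>v n"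
    proof (rule ccontr)
      assume "\<not> ?thesis"
      hence "y = 0\<^sub>v ?n" unfolding ad(3) using ad by (intro eq_vecI) auto
      thus False using y by simp
    qed
    moreover have "d \<bullet> (B' *\<^sub>v d) \<ge> 0" using pos_def_nonneg[OF B'(2,1) ad(2)] .
    moreover have "d \<bullet> (B' *\<^sub>v d) > 0" if "d \<noteq> 0\<^sub>v n" using pos_defD(2)[OF B'(2,1) ad(2) that] .
    ultimately have "sqrt e * (a $ 0)\<^sup>2 + d \<bullet> (B' *\<^sub>v d) > 0"
      using e by (cases "a $ 0 = 0") (auto intro: add_pos_nonneg)
    thus "y \<bullet> (B0 *\<^sub>v y) > 0" using form[OF ad(1,2) B'(1)] ad(3) by (simp add: B0_def)
  qed
  show ?case
  proof (intro bexI[of _ "W * B0 * W"] conjI)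
    show "pos_def (W * B0 * W)" using pos_def_congruence[OF pdB0 B0 W(1) detW] W(2) by simp
    \<comment> \<open>The reflection is its own inverse, so \<open>W * W\<close> cancels between the
      two copies of \<open>B0\<close> and then on both sides of \<open>A\<close>.\<close>
    have "(W * B0 * W) * (W * B0 * W) = W * B0 * (W * W) * B0 * W"
      using W(1) B0 by (simp add: assoc_mult_mat[of _ ?n ?n _ ?n _ ?n])
    also have "\<dots> = W * (B0 * B0) * W"
      using W(1,3) B0 by (simp add: assoc_mult_mat[of _ ?n ?n _ ?n _ ?n])
    also have "\<dots> = (W * W) * A * (W * W)"
      unfolding BB C_def using W(1) A by (simp add: assoc_mult_mat[of _ ?n ?n _ ?n _ ?n])
    also have "\<dots> = A" using A W(3) by simp
    finally show "(W * B0 * W) * (W * B0 * W) = A" .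
  qed (use W B0 in simp)
qed

text \<open>\<open>msqrt\<close> is a description over semidefinite roots, so it denotes the
  definite root \<open>B\<close> once every semidefinite root \<open>B'\<close> is known to equal
  \<open>B\<close>. The Sylvester lemma admits this pair: definite on the left, semidefinite on the
  right.\<close>

lemma msqrt_pos_def:
  assumes A: "A \<in> carrier_mat n n" and pd: "pos_def A"
  shows "msqrt A \<in> carrier_mat n n" "pos_def (msqrt A)" "msqrt A * msqrt A = A"
proof -
  obtain B where B: "B \<in> carrier_mat n n" "pos_def B" "B * B = A"
    using pos_def_sqrt_exists[OF A pd] by blast
  have n: "dim_row A = n" using A by simp
  have unique: "B' = B" if B': "B' \<in> carrier_mat n n" "pos_semidef B'" "B' * B' = A" for B'
  proof -
    \<comment> \<open>The mixed products \<open>B * B'\<close> cancel and both squares equal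
      \<open>A\<close>.\<close>
    have "B * (B - B') + (B - B') * B' = (B * B - B * B') + (B * B' - B' * B')"
      using mult_minus_distrib_mat[OF B(1,1) B'(1)] minus_mult_distrib_mat[OF B(1) B'(1,1)] by simp
    also have "\<dots> = 0\<^sub>m n n"
      unfolding B(3) B'(3) by (rule eq_matI) (use A B(1) B'(1) in auto)
    finally have "B - B' = 0\<^sub>m n n"
      using minus_carrier_mat[OF B'(1)] by (rule sylvester_zero[OF B(1,2) B'(1,2), rotated])
    hence "(B - B') $$ (i,j) = 0" if "i < n" "j < n" for i j using that by simp
    thus ?thesis using B(1) B'(1) by (intro eq_matI) fastforce+
  qed
  have "msqrt A = B"
    unfolding msqrt_def n
    using B(1,3) pos_def_imp_pos_semidef[OF B(2)] unique by (intro the_equality) blast+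
  thus "msqrt A \<in> carrier_mat n n" "pos_def (msqrt A)" "msqrt A * msqrt A = A"
    using B by blast+
qed

text \<open>The inner matrix is the congruence of \<open>S\<close> by the symmetric matrix
  \<open>msqrt X\<close>, hence positive definite. Its root is invertible, and
  \<open>nt_matrix\<close> is a product of three invertible factors.\<close>

lemma nt_matrix_det_nonzero:
  assumes X: "X \<in> carrier_mat n n" "pos_def X" and S: "S \<in> carrier_mat n n" "pos_def S"
  shows "nt_matrix X S \<in> carrier_mat n n" "det (nt_matrix X S) \<noteq> 0"
proof -
  note R = msqrt_pos_def[OF X]
  note dR = pos_def_det_nonzero[OF R(2,1)]
  let ?M = "msqrt X * S * msqrt X"
  have M: "?M \<in> carrier_mat n n" using R(1) S(1) by simp
  have "pos_def ?M"
    using pos_def_congruence[OF S(2,1) R(1) dR] unfolding pos_defD(1)[OF R(2,1)] .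
  note T = msqrt_pos_def[OF M this]
  note dT = pos_def_det_nonzero[OF T(2,1)]
  note I = minv_inverse[OF T(1) dT] det_minv[OF T(1) dT]
  show "nt_matrix X S \<in> carrier_mat n n" unfolding nt_matrix_def using R(1) I(1) by simp
  show "det (nt_matrix X S) \<noteq> 0"
    unfolding nt_matrix_def using R(1) I(1,4) dR by (simp add: det_mult[of _ n])
qed

section \<open>Symmetric vectorization and the symmetrized Kronecker product\<close>

text \<open>The index order of \<open>svec\<close> without the entries. Facts about
  \<open>svec\<close> reduce to this list being a duplicate-free enumeration of the lower
  triangle.\<close>

definition tril_positions :: "nat \<Rightarrow> (nat \<times> nat) list" where
  "tril_positions n = concat (map (\<lambda>c. map (\<lambda>r. (r, c)) [c..<n]) [0..<n])"

lemma set_tril_positions: "set (tril_positions n) = {(r, c). c \<le> r \<and> r < n}"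
  by (auto simp: tril_positions_def image_iff)

lemma length_tril_positions: "length (tril_positions n) = tri n"
proof -
  have "length (tril_positions n) = (\<Sum>c<n. n - c)"
    by (simp add: tril_positions_def length_concat comp_def interv_sum_list_conv_sum_set_nat lessThan_atLeast0)
  \<comment> \<open>Writing each column length as a successor prepares the reversal of the sum,
    which lists the lengths in increasing order.\<close>
  also have "\<dots> = (\<Sum>c<n. Suc (n - Suc c))" by (rule sum.cong) auto
  also have "\<dots> = (\<Sum>c<n. Suc c)" by (rule sum.nat_diff_reindex)
  also have "\<dots> = tri n" by (induction n) (auto simp: tri_def)
  finally show ?thesis .
qed

text \<open>A list whose set has as many elements as the list has entries contains no repetition.
  The list was counted column by column, the set is counted row by row.\<close>

lemma distinct_tril_positions: "distinct (tril_positions n)"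
proof -
  have "card (set (tril_positions n)) = (\<Sum>r<n. Suc r)"
  proof -
    have "set (tril_positions n) = (SIGMA r:{..<n}. {..r})" by (auto simp: set_tril_positions)
    thus ?thesis by (simp add: card_SigmaI)
  qed
  also have "\<dots> = tri n" by (induction n) (auto simp: tri_def)
  finally show ?thesis by (intro card_distinct) (simp add: length_tril_positions)
qed

lemma svec_positions:
  "svec A = vec_of_list (map (\<lambda>(r, c). if r = c then A $$ (r, c) else sqrt 2 * A $$ (r, c))
     (tril_positions (dim_row A)))"
  by (simp add: svec_def tril_positions_def map_concat comp_def)

lemma dim_svec [simp]: "dim_vec (svec A) = tri (dim_row A)"
  by (simp add: svec_positions length_tril_positions)

lemma svec_carrier: "A \<in> carrier_mat n m \<Longrightarrow> svec A \<in> carrier_vec (tri n)"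
  by (metis carrier_matD(1) carrier_vec_dim_vec dim_svec)

lemma svec_index:
  assumes "k < tri (dim_row A)" "tril_positions (dim_row A) ! k = (r, c)"
  shows "svec A $ k = (if r = c then 1 else sqrt 2) * A $$ (r, c)"
  using assms by (simp add: svec_positions length_tril_positions vec_of_list_index del: vec_of_list_map)

lemma tril_position_bounds:
  assumes "k < tri n" "tril_positions n ! k = (r, c)"
  shows "c \<le> r" "r < n"
  using nth_mem[of k "tril_positions n"] assms
  by (auto simp: set_tril_positions length_tril_positions)

lemma svec_add:
  assumes "A \<in> carrier_mat n n" "B \<in> carrier_mat n n"
  shows "svec (A + B) = svec A + svec B"
proof (rule eq_vecI)
  fix k assume "k < dim_vec (svec A + svec B)"
  hence k: "k < tri n" using assms by simp
  obtain r c where rc: "tril_positions n ! k = (r, c)" by (cases "tril_positions n ! k")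
  show "svec (A + B) $ k = (svec A + svec B) $ k"
    using k rc tril_position_bounds[OF k rc] assms
    by (simp add: svec_index[of k _ r c] distrib_left)
qed (use assms in auto)

lemma svec_smult:
  assumes "A \<in> carrier_mat n n"
  shows "svec (a \<cdot>\<^sub>m A) = a \<cdot>\<^sub>v svec A"
proof (rule eq_vecI)
  fix k assume "k < dim_vec (a \<cdot>\<^sub>v svec A)"
  hence k: "k < tri n" using assms by simp
  obtain r c where rc: "tril_positions n ! k = (r, c)" by (cases "tril_positions n ! k")
  show "svec (a \<cdot>\<^sub>m A) $ k = (a \<cdot>\<^sub>v svec A) $ k"
    using k rc tril_position_bounds[OF k rc] assms
    by (simp add: svec_index[of k _ r c])
qed (use assms in auto)

lemma svec_zero: "svec (0\<^sub>m n n) = 0\<^sub>v (tri n)"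
proof -
  have "svec (0\<^sub>m n n) = svec (0 \<cdot>\<^sub>m 0\<^sub>m n n)" by (rule arg_cong[of _ _ svec]) auto
  also have "\<dots> = 0 \<cdot>\<^sub>v svec (0\<^sub>m n n)" by (rule svec_smult[of _ n]) simp
  also have "\<dots> = 0\<^sub>v (tri n)" by (rule eq_vecI) auto
  finally show ?thesis .
qed

text \<open>Every entry of the lower triangle sits at exactly one position with a nonzero weight,
  and symmetry supplies the rest. This makes \<open>smat\<close>, defined through
  \<open>the_inv_into\<close>, a two-sided inverse of \<open>svec\<close>.\<close>

lemma svec_bij: "bij_betw svec (sym_mats n) (carrier_vec (tri n))"
proof (rule bij_betw_imageI)
  show "inj_on svec (sym_mats n)"
  proof (rule inj_onI)
    fix A B assume A: "A \<in> sym_mats n" and B: "B \<in> sym_mats n" and eq: "svec A = svec B"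
    have c: "A \<in> carrier_mat n n" "B \<in> carrier_mat n n" "A\<^sup>T = A" "B\<^sup>T = B"
      using A B by (auto simp: sym_mats_def)
    have low: "A $$ (i,j) = B $$ (i,j)" if "j \<le> i" "i < n" for i j
    proof -
      have "(i,j) \<in> set (tril_positions n)" using that by (simp add: set_tril_positions)
      then obtain k where k: "k < tri n" "tril_positions n ! k = (i,j)"
        by (metis in_set_conv_nth length_tril_positions)
      have "svec A $ k = svec B $ k" using eq by simp
      thus ?thesis using k c by (simp add: svec_index[of k _ i j] split: if_splits)
    qed
    show "A = B"
    proof (rule eq_matI)
      fix i j assume "i < dim_row B" "j < dim_col B"
      hence ij: "i < n" "j < n" using c by auto
      have "A $$ (i,j) = A $$ (j,i)" "B $$ (i,j) = B $$ (j,i)"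
        using c ij by (metis carrier_matD index_transpose_mat(1))+
      thus "A $$ (i,j) = B $$ (i,j)" using low[of j i] low[of i j] ij by (cases "j \<le> i") auto
    qed (use c in auto)
  qed
  show "svec ` sym_mats n = carrier_vec (tri n)"
  proof (intro equalityI subsetI)
    fix x assume "x \<in> svec ` sym_mats n"
    thus "x \<in> carrier_vec (tri n)" using svec_carrier by (auto simp: sym_mats_def)
  next
    fix x :: "real vec" assume x: "x \<in> carrier_vec (tri n)"
    \<comment> \<open>The inverse of the enumeration: it sends a pair of the lower triangle to its
      position.\<close>
    define pos where "pos = inv_into {..<tri n} (\<lambda>k. tril_positions n ! k)"
    have inj: "inj_on (\<lambda>k. tril_positions n ! k) {..<tri n}"
      using distinct_tril_positions[of n] by (auto simp: inj_on_def distinct_conv_nth length_tril_positions)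
    \<comment> \<open>\<open>max\<close> and \<open>min\<close> reflect a pair into the lower
      triangle, and the division undoes the factor \<open>sqrt 2\<close> of
      \<open>svec\<close>.\<close>
    define A where "A = mat n n (\<lambda>(i,j). x $ pos (max i j, min i j) / (if i = j then 1 else sqrt 2))"
    have A: "A \<in> sym_mats n"
      by (auto simp: sym_mats_def A_def max.commute min.commute intro!: eq_matI)
    have "svec A = x"
    proof (rule eq_vecI)
      fix k assume "k < dim_vec x"
      hence k: "k < tri n" using x by simp
      obtain r c where rc: "tril_positions n ! k = (r, c)" by (cases "tril_positions n ! k")
      note b = tril_position_bounds[OF k rc]
      have "pos (r, c) = k" using inv_into_f_f[OF inj, of k] k rc by (simp add: pos_def)
      moreover have "svec A $ k = (if r = c then 1 else sqrt 2) * A $$ (r, c)"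
        using k rc A by (intro svec_index) (auto simp: sym_mats_def)
      moreover have "A $$ (r, c) = x $ pos (r, c) / (if r = c then 1 else sqrt 2)"
        using b by (simp add: A_def max_absorb1 min_absorb2)
      ultimately show "svec A $ k = x $ k" by simp
    qed (use A x in \<open>auto simp: sym_mats_def\<close>)
    thus "x \<in> svec ` sym_mats n" using A by blast
  qed
qed

lemma smat_svec: "A \<in> sym_mats n \<Longrightarrow> smat n (svec A) = A"
  unfolding smat_def using svec_bij[of n] by (intro the_inv_into_f_f) (auto simp: bij_betw_def)

lemma svec_smat: "x \<in> carrier_vec (tri n) \<Longrightarrow> svec (smat n x) = x"
  unfolding smat_def using svec_bij[of n] by (intro f_the_inv_into_f) (auto simp: bij_betw_def)

lemma smat_sym: "x \<in> carrier_vec (tri n) \<Longrightarrow> smat n x \<in> sym_mats n"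
  unfolding smat_def using svec_bij[of n] by (intro the_inv_into_into) (auto simp: bij_betw_def)

lemma sym_mats_add: "A \<in> sym_mats n \<Longrightarrow> B \<in> sym_mats n \<Longrightarrow> A + B \<in> sym_mats n"
  by (auto simp: sym_mats_def transpose_add)

lemma sym_mats_smult: "A \<in> sym_mats n \<Longrightarrow> a \<cdot>\<^sub>m A \<in> sym_mats n"
proof -
  assume "A \<in> sym_mats n"
  moreover have "(a \<cdot>\<^sub>m A)\<^sup>T = a \<cdot>\<^sub>m A\<^sup>T" by (rule eq_matI) auto
  ultimately show ?thesis by (auto simp: sym_mats_def)
qed

lemma smat_add:
  assumes "x \<in> carrier_vec (tri n)" "y \<in> carrier_vec (tri n)"
  shows "smat n (x + y) = smat n x + smat n y"
proof -
  have s: "smat n x \<in> sym_mats n" "smat n y \<in> sym_mats n" using assms smat_sym by auto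
  hence "svec (smat n x + smat n y) = x + y"
    using svec_add[of "smat n x" n "smat n y"] svec_smat assms by (auto simp: sym_mats_def)
  thus ?thesis using smat_svec[OF sym_mats_add[OF s]] by simp
qed

lemma smat_smult:
  assumes "x \<in> carrier_vec (tri n)"
  shows "smat n (a \<cdot>\<^sub>v x) = a \<cdot>\<^sub>m smat n x"
proof -
  have s: "smat n x \<in> sym_mats n" using assms smat_sym by auto
  hence "svec (a \<cdot>\<^sub>m smat n x) = a \<cdot>\<^sub>v x"
    using svec_smult[of "smat n x" n a] svec_smat assms by (auto simp: sym_mats_def)
  thus ?thesis using smat_svec[OF sym_mats_smult[OF s]] by metis
qed

section \<open>Matrices of linear maps\<close>

text \<open>The columns are the images of the unit vectors; additivity and homogeneity extend the
  agreement to all vectors.\<close>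

lemma linear_map_matrix_exists:
  fixes g :: "real vec \<Rightarrow> real vec"
  assumes g: "\<And>x. x \<in> carrier_vec t \<Longrightarrow> g x \<in> carrier_vec m"
    and add: "\<And>x y. x \<in> carrier_vec t \<Longrightarrow> y \<in> carrier_vec t \<Longrightarrow> g (x + y) = g x + g y"
    and smult: "\<And>a x. x \<in> carrier_vec t \<Longrightarrow> g (a \<cdot>\<^sub>v x) = a \<cdot>\<^sub>v g x"
  shows "\<exists>M \<in> carrier_mat m t. \<forall>x \<in> carrier_vec t. M *\<^sub>v x = g x"
proof (intro bexI ballI)
  define M where "M = mat m t (\<lambda>(i,j). g (unit_vec t j) $ i)"
  show M: "M \<in> carrier_mat m t" by (simp add: M_def)
  fix x :: "real vec" assume x: "x \<in> carrier_vec t"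
  \<comment> \<open>\<open>xs k\<close> keeps the first \<open>k\<close> entries of
    \<open>x\<close>, so the expansion in unit vectors is built one term at a time.\<close>
  define xs where "xs k = vec t (\<lambda>i. if i < k then x $ i else 0)" for k
  have xs: "xs k \<in> carrier_vec t" for k by (simp add: xs_def)
  have part: "g (xs k) $ i = (\<Sum>j<k. g (unit_vec t j) $ i * x $ j)" if "k \<le> t" "i < m" for k i
    using that(1)
  proof (induction k)
    case 0
    \<comment> \<open>Homogeneity with factor 0 forces \<open>g\<close> to vanish at the zero
      vector.\<close>
    have "xs 0 = 0 \<cdot>\<^sub>v xs 0" by (auto simp: xs_def)
    hence "g (xs 0) = 0 \<cdot>\<^sub>v g (xs 0)" using smult[OF xs] by metis
    hence "g (xs 0) $ i = 0 * g (xs 0) $ i"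
      using g[OF xs[of 0]] that(2) by (metis carrier_vecD index_smult_vec(1))
    thus ?case by simp
  next
    case (Suc k)
    have "xs (Suc k) = xs k + x $ k \<cdot>\<^sub>v unit_vec t k"
      using Suc.prems by (auto simp: xs_def less_Suc_eq intro!: eq_vecI)
    hence "g (xs (Suc k)) = g (xs k) + x $ k \<cdot>\<^sub>v g (unit_vec t k)"
      using add[OF xs[of k], of "x $ k \<cdot>\<^sub>v unit_vec t k"] smult[of "unit_vec t k" "x $ k"] by simp
    hence "g (xs (Suc k)) $ i = g (xs k) $ i + x $ k * g (unit_vec t k) $ i"
      using g[OF xs[of k]] g[of "unit_vec t k"] that(2) by simp
    thus ?case using Suc by (simp add: mult.commute)
  qed
  have "xs t = x" using x by (auto simp: xs_def)
  show "M *\<^sub>v x = g x"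
  proof (rule eq_vecI)
    fix i assume "i < dim_vec (g x)"
    hence i: "i < m" using g[OF x] by simp
    show "(M *\<^sub>v x) $ i = g x $ i"
      using part[OF order_refl i] \<open>xs t = x\<close> i x
      by (simp add: M_def mult_mat_vec_def scalar_prod_def lessThan_atLeast0)
  qed (use g[OF x] M in auto)
qed

lemma mat_eqI_mult_vec:
  fixes A B :: "real mat"
  assumes A: "A \<in> carrier_mat m n" and B: "B \<in> carrier_mat m n"
    and eq: "\<And>x. x \<in> carrier_vec n \<Longrightarrow> A *\<^sub>v x = B *\<^sub>v x"
  shows "A = B"
proof (rule eq_matI)
  fix i j assume "i < dim_row B" "j < dim_col B"
  thus "A $$ (i,j) = B $$ (i,j)"
    using A B arg_cong[OF eq[of "unit_vec n j"], of "\<lambda>y. y $ i"] by (simp add: scalar_prod_right_unit)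
qed (use A B in auto)

section \<open>The symmetrized Kronecker product\<close>

text \<open>Transposition exchanges the two summands because \<open>K\<close> is symmetric.\<close>

lemma skron_sym:
  fixes P R :: "real mat"
  assumes P: "P \<in> carrier_mat k n" and R: "R \<in> carrier_mat k n" and K: "K \<in> sym_mats n"
  shows "(1/2) \<cdot>\<^sub>m (R * K * P\<^sup>T + P * K * R\<^sup>T) \<in> sym_mats k"
proof (rule sym_mats_smult)
  have c: "K \<in> carrier_mat n n" "K\<^sup>T = K" using K by (auto simp: sym_mats_def)
  have "(R * K * P\<^sup>T + P * K * R\<^sup>T)\<^sup>T = (R * K * P\<^sup>T)\<^sup>T + (P * K * R\<^sup>T)\<^sup>T"
    using c P R by (intro transpose_add) auto
  also have "(R * K * P\<^sup>T)\<^sup>T = P * K * R\<^sup>T"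
    using c P R by (simp add: transpose_mult[of _ k n _ k] transpose_mult[of _ k n _ n] transpose_mult[of _ n n _ k])
  also have "(P * K * R\<^sup>T)\<^sup>T = R * K * P\<^sup>T"
    using c P R by (simp add: transpose_mult[of _ k n _ k] transpose_mult[of _ k n _ n] transpose_mult[of _ n n _ k])
  also have "P * K * R\<^sup>T + R * K * P\<^sup>T = R * K * P\<^sup>T + P * K * R\<^sup>T"
    using c P R by (intro comm_add_mat) auto
  finally show "R * K * P\<^sup>T + P * K * R\<^sup>T \<in> sym_mats k" using c P R by (auto simp: sym_mats_def)
qed

text \<open>A representing matrix exists because the map is linear in \<open>K\<close> and is
  carried to vectors by \<open>svec\<close> and \<open>smat\<close>; it is unique because
  \<open>svec\<close> reaches every vector. Hence the description in \<open>skron\<close> denotes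
  it.\<close>

lemma skron:
  assumes P: "P \<in> carrier_mat k n" and R: "R \<in> carrier_mat k n"
  shows "P \<otimes>\<^sub>s R \<in> carrier_mat (tri k) (tri n)"
    and "\<And>K. K \<in> sym_mats n \<Longrightarrow>
      (P \<otimes>\<^sub>s R) *\<^sub>v svec K = svec ((1/2) \<cdot>\<^sub>m (R * K * P\<^sup>T + P * K * R\<^sup>T))"
proof -
  define L where "L K = (1/2) \<cdot>\<^sub>m (R * K * P\<^sup>T + P * K * R\<^sup>T)" for K
  have L: "L K \<in> sym_mats k" if "K \<in> sym_mats n" for K
    unfolding L_def by (rule skron_sym[OF P R that])
  have Lc: "L K \<in> carrier_mat k k" for K unfolding L_def using P R by auto
  have L_add: "L (A + B) = L A + L B" if "A \<in> carrier_mat n n" "B \<in> carrier_mat n n" for A B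
    unfolding L_def using P R that
    by (auto simp: mult_add_distrib_mat[of _ k n _ n] add_mult_distrib_mat[of _ k n _ _ k] field_simps
        intro!: eq_matI)
  have L_smult: "L (a \<cdot>\<^sub>m A) = a \<cdot>\<^sub>m L A" if "A \<in> carrier_mat n n" for a A
  proof -
    have "R * (a \<cdot>\<^sub>m A) * P\<^sup>T = a \<cdot>\<^sub>m (R * A * P\<^sup>T)" "P * (a \<cdot>\<^sub>m A) * R\<^sup>T = a \<cdot>\<^sub>m (P * A * R\<^sup>T)"
      using P R that by (simp_all add: mult_smult_distrib[of _ k n _ n] mult_smult_assoc_mat[of _ k n _ k])
    thus ?thesis unfolding L_def using P R by (auto intro!: eq_matI simp: algebra_simps)
  qed
  have "\<exists>M \<in> carrier_mat (tri k) (tri n). \<forall>x \<in> carrier_vec (tri n). M *\<^sub>v x = svec (L (smat n x))"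
  proof (rule linear_map_matrix_exists)
    fix x y :: "real vec" and a :: real assume x: "x \<in> carrier_vec (tri n)"
    have sx: "smat n x \<in> carrier_mat n n" using smat_sym[OF x] by (simp add: sym_mats_def)
    show "svec (L (smat n x)) \<in> carrier_vec (tri k)" using svec_carrier[OF Lc] .
    show "svec (L (smat n (a \<cdot>\<^sub>v x))) = a \<cdot>\<^sub>v svec (L (smat n x))"
      using x sx by (simp add: smat_smult L_smult svec_smult[OF Lc])
    assume y: "y \<in> carrier_vec (tri n)"
    have sy: "smat n y \<in> carrier_mat n n" using smat_sym[OF y] by (simp add: sym_mats_def)
    show "svec (L (smat n (x + y))) = svec (L (smat n x)) + svec (L (smat n y))"
      using x sx y sy by (simp add: smat_add L_add svec_add[OF Lc Lc])
  qed
  then obtain M where M: "M \<in> carrier_mat (tri k) (tri n)"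
    "\<And>x. x \<in> carrier_vec (tri n) \<Longrightarrow> M *\<^sub>v x = svec (L (smat n x))" by blast
  have MK: "M *\<^sub>v svec K = svec (L K)" if "K \<in> sym_mats n" for K
    using M(2)[of "svec K"] that smat_svec[OF that] svec_carrier[of K n n] by (auto simp: sym_mats_def)
  have "P \<otimes>\<^sub>s R = M"
    unfolding skron_def
  proof (rule the_equality)
    show "M \<in> carrier_mat (tri (dim_row P)) (tri (dim_col P)) \<and>
      (\<forall>K \<in> sym_mats (dim_col P). M *\<^sub>v svec K = svec ((1/2) \<cdot>\<^sub>m (R * K * P\<^sup>T + P * K * R\<^sup>T)))"
      using M(1) MK P by (simp add: L_def)
    fix M' assume *: "M' \<in> carrier_mat (tri (dim_row P)) (tri (dim_col P)) \<and>
      (\<forall>K \<in> sym_mats (dim_col P). M' *\<^sub>v svec K = svec ((1/2) \<cdot>\<^sub>m (R * K * P\<^sup>T + P * K * R\<^sup>T)))"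
    show "M' = M"
    proof (rule mat_eqI_mult_vec[of _ "tri k" "tri n"])
      fix x :: "real vec" assume x: "x \<in> carrier_vec (tri n)"
      have "M' *\<^sub>v svec (smat n x) = svec (L (smat n x))"
        using * smat_sym[OF x] P by (simp add: L_def)
      thus "M' *\<^sub>v x = M *\<^sub>v x" using M(2)[OF x] svec_smat[OF x] by simp
    qed (use * M P in auto)
  qed
  thus "P \<otimes>\<^sub>s R \<in> carrier_mat (tri k) (tri n)"
    and "\<And>K. K \<in> sym_mats n \<Longrightarrow>
      (P \<otimes>\<^sub>s R) *\<^sub>v svec K = svec ((1/2) \<cdot>\<^sub>m (R * K * P\<^sup>T + P * K * R\<^sup>T))"
    using M(1) MK by (auto simp: L_def)
qed

text \<open>With \<open>Y = D X D\<^sup>T\<close> and \<open>K' = D\<^sup>-\<^sup>T K D\<^sup>-\<^sup>1\<close>, the kernel equation becomes \<open>Y K' + K' Y = 0\<close>.\<close>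
lemma scaled_skron_det_nonzero:
  assumes D: "D \<in> carrier_mat n n" "det D \<noteq> 0" and X: "X \<in> carrier_mat n n" "pos_def X"
  shows "det ((D * X) \<otimes>\<^sub>s (minv D)\<^sup>T) \<noteq> 0"
proof -
  let ?I = "minv D"
  note I = minv_inverse[OF D]
  have IT: "?I\<^sup>T * D\<^sup>T = 1\<^sub>m n" "D\<^sup>T * ?I\<^sup>T = 1\<^sub>m n"
    unfolding transpose_mult[OF D(1) I(1), symmetric] transpose_mult[OF I(1) D(1), symmetric] I(2,3)
    by simp_all
  have XT: "X\<^sup>T = X" using pos_defD(1)[OF X(2,1)] .
  define Y where "Y = D * X * D\<^sup>T"
  have Y: "Y \<in> carrier_mat n n" using D X by (simp add: Y_def)
  have pdY: "pos_def Y"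
    using pos_def_congruence[OF X(2,1), of "D\<^sup>T"] D by (simp add: Y_def det_transpose)
  have F: "(D * X) \<otimes>\<^sub>s ?I\<^sup>T \<in> carrier_mat (tri n) (tri n)"
    using D X I by (intro skron(1)) auto
  show ?thesis
    unfolding det_nonzero_iff_trivial_kernel[OF F]
  proof (intro ballI impI)
    fix x assume x: "x \<in> carrier_vec (tri n)" "((D * X) \<otimes>\<^sub>s ?I\<^sup>T) *\<^sub>v x = 0\<^sub>v (tri n)"
    define K where "K = smat n x"
    have K: "K \<in> sym_mats n" "svec K = x" using smat_sym svec_smat x by (auto simp: K_def)
    have Kc: "K \<in> carrier_mat n n" using K by (simp add: sym_mats_def)
    define K' where "K' = ?I\<^sup>T * K * ?I"
    have K': "K' \<in> carrier_mat n n" using Kc I by (simp add: K'_def)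
    let ?H = "?I\<^sup>T * K * (D * X)\<^sup>T + D * X * K * (?I\<^sup>T)\<^sup>T"
    have Hc: "?H \<in> carrier_mat n n" using D X I Kc by (intro add_carrier_mat mult_carrier_mat[of _ n n]) auto
    \<comment> \<open>Injectivity of \<open>svec\<close> on symmetric matrices turns the kernel
      equation for \<open>x\<close> into a matrix equation for \<open>K\<close>.\<close>
    have "svec ((1/2) \<cdot>\<^sub>m ?H) = svec (0\<^sub>m n n)"
      using skron(2)[of "D * X" n n "?I\<^sup>T" K] D X I K x by (simp add: svec_zero)
    moreover have "(1/2) \<cdot>\<^sub>m ?H \<in> sym_mats n"
      using skron_sym[of "D * X" n n "?I\<^sup>T" K] D X I K by simp
    moreover have "0\<^sub>m n n \<in> sym_mats n" by (simp add: sym_mats_def)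
    ultimately have "(1/2) \<cdot>\<^sub>m ?H = 0\<^sub>m n n"
      using svec_bij[of n] by (auto simp: bij_betw_def dest: inj_onD)
    hence "?H $$ (i,j) = 0" if "i < n" "j < n" for i j
      using arg_cong[of "(1/2) \<cdot>\<^sub>m ?H" "0\<^sub>m n n" "\<lambda>A. A $$ (i,j)"] that Hc
      by (metis carrier_matD index_smult_mat(1) index_zero_mat(1) mult_eq_0_iff divide_eq_0_iff zero_neq_numeral zero_neq_one)
    hence H0: "?H = 0\<^sub>m n n" using Hc by (intro eq_matI) auto
    \<comment> \<open>The adjacent factors \<open>?I\<close> and \<open>D\<close> cancel, leaving
      one summand of \<open>?H\<close>; the product in the other order gives the other
      summand.\<close>
    have "K' * Y = ?I\<^sup>T * K * (?I * D) * X * D\<^sup>T"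
      unfolding K'_def Y_def using D X I(1) Kc by (simp add: assoc_mult_mat[of _ n n _ n _ n])
    also have "\<dots> = ?I\<^sup>T * K * (D * X)\<^sup>T"
      using D X I Kc XT by (simp add: transpose_mult[of _ n n _ n] assoc_mult_mat[of _ n n _ n _ n])
    finally have 1: "K' * Y = ?I\<^sup>T * K * (D * X)\<^sup>T" .
    have "Y * K' = D * X * (D\<^sup>T * ?I\<^sup>T) * K * ?I"
      unfolding K'_def Y_def using D X I(1) Kc by (simp add: assoc_mult_mat[of _ n n _ n _ n])
    also have "\<dots> = D * X * K * (?I\<^sup>T)\<^sup>T"
      unfolding IT using D X I(1) Kc by simp
    finally have 2: "Y * K' = D * X * K * (?I\<^sup>T)\<^sup>T" .
    have "Y * K' + K' * Y = ?H"
      unfolding 1 2 using D X I Kc by (intro comm_add_mat) auto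
    hence "K' = 0\<^sub>m n n"
      using sylvester_zero[OF Y pdY Y pos_def_imp_pos_semidef[OF pdY] K'] H0 by simp
    \<comment> \<open>Undoing the scaling recovers \<open>K\<close> from \<open>K'\<close>.\<close>
    moreover have "D\<^sup>T * K' * D = (D\<^sup>T * ?I\<^sup>T) * K * (?I * D)"
      unfolding K'_def using D I(1) Kc by (simp add: assoc_mult_mat[of _ n n _ n _ n])
    hence "D\<^sup>T * K' * D = K" unfolding IT I using Kc by simp
    ultimately have "K = 0\<^sub>m n n" using D by simp
    thus "x = 0\<^sub>v (tri n)" using K(2) svec_zero by simp
  qed
qed

section \<open>Block vectors and block-diagonal matrices\<close>

lemma stack_vec_Cons [simp]: "stack_vec (v # vs) = v @\<^sub>v stack_vec vs"
  by (simp add: stack_vec_def)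

lemma stack_vec_Nil [simp]: "stack_vec [] = 0\<^sub>v 0"
  by (simp add: stack_vec_def)

lemma stack_vec_carrier:
  assumes "\<And>i. i \<in> set xs \<Longrightarrow> f i \<in> carrier_vec (d i)"
  shows "stack_vec (map f xs) \<in> carrier_vec (sum_list (map d xs))"
  using assms by (induction xs) auto

lemma stack_vec_add:
  assumes "\<And>i. i \<in> set xs \<Longrightarrow> f i \<in> carrier_vec (d i)"
    and "\<And>i. i \<in> set xs \<Longrightarrow> g i \<in> carrier_vec (d i)"
  shows "stack_vec (map f xs) + stack_vec (map g xs) = stack_vec (map (\<lambda>i. f i + g i) xs)"
  using assms
proof (induction xs)
  case Nil
  show ?case by (intro eq_vecI) auto
next
  case (Cons x xs)
  have "stack_vec (map f xs) \<in> carrier_vec (sum_list (map d xs))"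
    "stack_vec (map g xs) \<in> carrier_vec (sum_list (map d xs))"
    using Cons.prems by (auto intro!: stack_vec_carrier)
  thus ?case using Cons by (simp add: append_vec_add[of _ "d x" _ _ "sum_list (map d xs)"])
qed

text \<open>Follows from additivity: blockwise, \<open>f - g\<close> plus \<open>g\<close> is
  \<open>f\<close>, and the stacked \<open>g\<close> is then subtracted.\<close>

lemma stack_vec_minus:
  fixes f g :: "nat \<Rightarrow> real vec"
  assumes "\<And>i. i \<in> set xs \<Longrightarrow> f i \<in> carrier_vec (d i)"
    and "\<And>i. i \<in> set xs \<Longrightarrow> g i \<in> carrier_vec (d i)"
  shows "stack_vec (map f xs) - stack_vec (map g xs) = stack_vec (map (\<lambda>i. f i - g i) xs)"
proof -
  let ?n = "sum_list (map d xs)"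
  have "f i - g i + g i = f i" if "i \<in> set xs" for i
    using assms(1)[OF that] assms(2)[OF that] by (intro eq_vecI) auto
  hence "stack_vec (map (\<lambda>i. f i - g i) xs) + stack_vec (map g xs) = stack_vec (map f xs)"
    using assms by (subst stack_vec_add[of xs _ d]) (auto intro!: arg_cong[of _ _ stack_vec])
  moreover have "stack_vec (map (\<lambda>i. f i - g i) xs) \<in> carrier_vec ?n" "stack_vec (map g xs) \<in> carrier_vec ?n"
    using assms by (auto intro!: stack_vec_carrier)
  moreover have "x + y - y = x" if "x \<in> carrier_vec ?n" "y \<in> carrier_vec ?n" for x y :: "real vec"
    using that by (intro eq_vecI) auto
  ultimately show ?thesis by metis
qed

lemma zero_mat_mult_vec:
  fixes v :: "real vec"
  assumes "v \<in> carrier_vec n"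
  shows "0\<^sub>m m n *\<^sub>v v = 0\<^sub>v m"
  using assms by (intro eq_vecI) auto

section \<open>Block-diagonal matrices\<close>

lemma diag_block_mat_carrier:
  assumes "\<And>i. i \<in> set xs \<Longrightarrow> A i \<in> carrier_mat (m i) (d i)"
  shows "diag_block_mat (map A xs) \<in> carrier_mat (sum_list (map m xs)) (sum_list (map d xs))"
  using assms by (induction xs) (auto simp: Let_def)

text \<open>Induction on the list: the two off-diagonal zero blocks contribute zero vectors, so the
  first block and the remaining ones act separately.\<close>

lemma diag_block_mat_mult_stack_vec:
  fixes A :: "nat \<Rightarrow> real mat"
  assumes "\<And>i. i \<in> set xs \<Longrightarrow> A i \<in> carrier_mat (m i) (d i)"
    and "\<And>i. i \<in> set xs \<Longrightarrow> f i \<in> carrier_vec (d i)"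
  shows "diag_block_mat (map A xs) *\<^sub>v stack_vec (map f xs) = stack_vec (map (\<lambda>i. A i *\<^sub>v f i) xs)"
  using assms
proof (induction xs)
  case Nil
  show ?case by (intro eq_vecI) auto
next
  case (Cons x xs)
  let ?B = "diag_block_mat (map A xs)"
  have B: "?B \<in> carrier_mat (sum_list (map m xs)) (sum_list (map d xs))"
    using Cons.prems by (intro diag_block_mat_carrier) auto
  have v: "stack_vec (map f xs) \<in> carrier_vec (sum_list (map d xs))"
    using Cons.prems by (intro stack_vec_carrier) auto
  have x: "A x \<in> carrier_mat (m x) (d x)" "f x \<in> carrier_vec (d x)" using Cons.prems by auto
  have "diag_block_mat (map A (x # xs)) *\<^sub>v stack_vec (map f (x # xs))
      = A x *\<^sub>v f x @\<^sub>v ?B *\<^sub>v stack_vec (map f xs)"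
  proof -
    have "diag_block_mat (map A (x # xs)) *\<^sub>v stack_vec (map f (x # xs))
        = (A x *\<^sub>v f x + 0\<^sub>m (m x) (sum_list (map d xs)) *\<^sub>v stack_vec (map f xs)) @\<^sub>v
          (0\<^sub>m (sum_list (map m xs)) (d x) *\<^sub>v f x + ?B *\<^sub>v stack_vec (map f xs))"
      using four_block_mat_mult_vec[OF x(1) zero_carrier_mat zero_carrier_mat B x(2) v]
      using carrier_matD[OF x(1)] carrier_matD[OF B] by (simp only: list.map diag_block_mat.simps Let_def stack_vec_Cons)
    also have "\<dots> = A x *\<^sub>v f x @\<^sub>v ?B *\<^sub>v stack_vec (map f xs)"
      unfolding zero_mat_mult_vec[OF v] zero_mat_mult_vec[OF x(2)]
      using mult_mat_vec_carrier[OF x] mult_mat_vec_carrier[OF B v] by simp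
    finally show ?thesis .
  qed
  thus ?case using Cons by simp
qed

lemma transpose_diag_block_mat:
  fixes A :: "nat \<Rightarrow> real mat"
  shows "(diag_block_mat (map A xs))\<^sup>T = diag_block_mat (map (\<lambda>i. (A i)\<^sup>T) xs)"
proof (induction xs)
  case (Cons x xs)
  let ?B = "diag_block_mat (map A xs)"
  have c: "A x \<in> carrier_mat (dim_row (A x)) (dim_col (A x))" "?B \<in> carrier_mat (dim_row ?B) (dim_col ?B)"
    by simp_all
  show ?case
    unfolding list.map diag_block_mat.simps Let_def
      transpose_four_block_mat[OF c(1) zero_carrier_mat zero_carrier_mat c(2)] zero_transpose_mat
    unfolding Cons.IH[symmetric] index_transpose_mat(2,3) ..
qed simp

text \<open>Splitting off one block at a time leaves a block-triangular determinant, the product of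
  two nonzero factors.\<close>

lemma det_diag_block_mat_nonzero:
  fixes A :: "nat \<Rightarrow> real mat"
  assumes "\<And>i. i \<in> set xs \<Longrightarrow> A i \<in> carrier_mat (d i) (d i)"
    and "\<And>i. i \<in> set xs \<Longrightarrow> det (A i) \<noteq> 0"
  shows "det (diag_block_mat (map A xs)) \<noteq> 0"
  using assms
proof (induction xs)
  case (Cons x xs)
  let ?B = "diag_block_mat (map A xs)"
  have B: "?B \<in> carrier_mat (sum_list (map d xs)) (sum_list (map d xs))"
    using Cons.prems by (intro diag_block_mat_carrier) auto
  have x: "A x \<in> carrier_mat (d x) (d x)" using Cons.prems by auto
  have "det (diag_block_mat (map A (x # xs))) = det (A x) * det ?B"
    using x B by (simp add: Let_def det_four_block_mat_lower_left_zero[OF x zero_carrier_mat _ B])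
  thus ?case using Cons by simp
qed simp

section \<open>Matrices stacked by rows\<close>

lemma stack_rows_Cons: "stack_rows c (A # As) = A @\<^sub>r stack_rows c As"
  by (simp add: stack_rows_def)

lemma stack_rows_carrier:
  assumes "\<And>i. i \<in> set xs \<Longrightarrow> A i \<in> carrier_mat (m i) c"
  shows "stack_rows c (map A xs) \<in> carrier_mat (sum_list (map m xs)) c"
  using assms
proof (induction xs)
  case Nil
  show ?case by (simp add: stack_rows_def)
next
  case (Cons x xs)
  have "A x \<in> carrier_mat (m x) c" "stack_rows c (map A xs) \<in> carrier_mat (sum_list (map m xs)) c"
    using Cons by simp_all
  from carrier_append_rows[OF this] show ?case by (simp only: list.map stack_rows_Cons sum_list.Cons)
qed

lemma stack_rows_mult_vec:
  fixes A :: "nat \<Rightarrow> real mat"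
  assumes "\<And>i. i \<in> set xs \<Longrightarrow> A i \<in> carrier_mat (m i) c" and v: "v \<in> carrier_vec c"
  shows "stack_rows c (map A xs) *\<^sub>v v = stack_vec (map (\<lambda>i. A i *\<^sub>v v) xs)"
  using assms(1)
proof (induction xs)
  case Nil
  show ?case by (intro eq_vecI) (simp_all add: stack_rows_def)
next
  case (Cons x xs)
  have "A x \<in> carrier_mat (m x) c" "stack_rows c (map A xs) \<in> carrier_mat (sum_list (map m xs)) c"
    using Cons.prems stack_rows_carrier[of xs A m c] by simp_all
  from mat_mult_append[OF this v] Cons show ?case
    by (simp only: list.map stack_rows_Cons stack_vec_Cons list.set_intros)
qed

section \<open>The block linear system\<close>

lemma append_vec_assoc: "(u @\<^sub>v v) @\<^sub>v w = u @\<^sub>v v @\<^sub>v w"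
  by (rule eq_vecI) auto

text \<open>The linear algebra of the theorem, with \<open>H\<close> for the inverse of
  \<open>F\<close> times \<open>U\<close>. The first block row cancels by the definition of
  \<open>w\<close>, the second is stationarity after adding the term in \<open>r\<close>, and the
  last two are \<open>feas\<close> and the equation for \<open>x\<close>. Rows and columns are
  grouped in pairs to fit the nested \<open>four_block_mat\<close>.\<close>

lemma kkt_block_system:
  fixes H E Q :: "real mat"
  assumes H: "H \<in> carrier_mat M M" and E: "E \<in> carrier_mat M t" and Q: "Q \<in> carrier_mat p M"
    and y: "y \<in> carrier_vec t" and v: "v \<in> carrier_vec p" and r: "r \<in> carrier_vec M"
    and x: "E *\<^sub>v y = x" and feas: "Q *\<^sub>v x = b"
    and stat: "E\<^sup>T *\<^sub>v (H *\<^sub>v x - Q\<^sup>T *\<^sub>v v) = - (E\<^sup>T *\<^sub>v r)"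
    and w: "w = H *\<^sub>v x + r - Q\<^sup>T *\<^sub>v v"
  shows "four_block_mat
      (four_block_mat (- H) (0\<^sub>m M t) (0\<^sub>m t M) (0\<^sub>m t t))
      (four_block_mat (Q\<^sup>T) (1\<^sub>m M) (0\<^sub>m t p) (- (E\<^sup>T)))
      (four_block_mat Q (0\<^sub>m p t) (1\<^sub>m M) (- E))
      (four_block_mat (0\<^sub>m p p) (0\<^sub>m p M) (0\<^sub>m M p) (0\<^sub>m M M))
      *\<^sub>v (x @\<^sub>v y @\<^sub>v v @\<^sub>v w) = r @\<^sub>v 0\<^sub>v t @\<^sub>v b @\<^sub>v 0\<^sub>v M"
proof -
  have xc: "x \<in> carrier_vec M" unfolding x[symmetric] by (rule mult_mat_vec_carrier[OF E y])
  have bc: "b \<in> carrier_vec p" unfolding feas[symmetric] by (rule mult_mat_vec_carrier[OF Q xc])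
  have ET: "E\<^sup>T \<in> carrier_mat t M" and QT: "Q\<^sup>T \<in> carrier_mat M p" using E Q by simp_all
  have Hx: "H *\<^sub>v x \<in> carrier_vec M" by (rule mult_mat_vec_carrier[OF H xc])
  have Qv: "Q\<^sup>T *\<^sub>v v \<in> carrier_vec M" by (rule mult_mat_vec_carrier[OF QT v])
  have Er: "E\<^sup>T *\<^sub>v r \<in> carrier_vec t" by (rule mult_mat_vec_carrier[OF ET r])
  have wc: "w \<in> carrier_vec M" unfolding w using Hx r Qv by simp
  have Ew: "E\<^sup>T *\<^sub>v w = 0\<^sub>v t"
  proof -
    \<comment> \<open>Regrouping isolates the vector to which \<open>stat\<close> applies.\<close>
    have "w = (H *\<^sub>v x - Q\<^sup>T *\<^sub>v v) + r"
      unfolding w by (rule eq_vecI) (use carrier_vecD[OF r] carrier_vecD[OF Hx] carrier_vecD[OF Qv] in simp_all)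
    hence "E\<^sup>T *\<^sub>v w = E\<^sup>T *\<^sub>v (H *\<^sub>v x - Q\<^sup>T *\<^sub>v v) + E\<^sup>T *\<^sub>v r"
      using mult_add_distrib_mat_vec[OF ET minus_carrier_vec[OF Hx Qv] r] by simp
    thus ?thesis unfolding stat using Er by simp
  qed
  have nH: "- H \<in> carrier_mat M M" and nET: "- (E\<^sup>T) \<in> carrier_mat t M" and nE: "- E \<in> carrier_mat M t"
    using H E ET by simp_all
  have A: "four_block_mat (- H) (0\<^sub>m M t) (0\<^sub>m t M) (0\<^sub>m t t) *\<^sub>v (x @\<^sub>v y) = (- (H *\<^sub>v x)) @\<^sub>v 0\<^sub>v t"
    unfolding four_block_mat_mult_vec[OF nH zero_carrier_mat zero_carrier_mat zero_carrier_mat xc y]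
      zero_mat_mult_vec[OF xc] zero_mat_mult_vec[OF y]
    using carrier_vecD[OF xc] carrier_matD[OF H] Hx by simp
  have B: "four_block_mat (Q\<^sup>T) (1\<^sub>m M) (0\<^sub>m t p) (- (E\<^sup>T)) *\<^sub>v (v @\<^sub>v w) = (Q\<^sup>T *\<^sub>v v + w) @\<^sub>v 0\<^sub>v t"
    unfolding four_block_mat_mult_vec[OF QT one_carrier_mat zero_carrier_mat nET v wc] zero_mat_mult_vec[OF v]
    using carrier_vecD[OF wc] carrier_matD[OF ET] wc Ew by simp
  have C: "four_block_mat Q (0\<^sub>m p t) (1\<^sub>m M) (- E) *\<^sub>v (x @\<^sub>v y) = b @\<^sub>v 0\<^sub>v M"
    unfolding four_block_mat_mult_vec[OF Q zero_carrier_mat one_carrier_mat nE xc y] zero_mat_mult_vec[OF y]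
    using carrier_vecD[OF y] carrier_matD[OF E] xc bc x feas by simp
  have D: "four_block_mat (0\<^sub>m p p) (0\<^sub>m p M) (0\<^sub>m M p) (0\<^sub>m M M) *\<^sub>v (v @\<^sub>v w) = 0\<^sub>v p @\<^sub>v 0\<^sub>v M"
    unfolding four_block_mat_mult_vec[OF zero_carrier_mat zero_carrier_mat zero_carrier_mat zero_carrier_mat v wc]
      zero_mat_mult_vec[OF v] zero_mat_mult_vec[OF wc] by simp
  have 1: "- (H *\<^sub>v x) + (Q\<^sup>T *\<^sub>v v + w) = r"
    unfolding w by (rule eq_vecI) (use carrier_vecD[OF r] carrier_vecD[OF Hx] carrier_vecD[OF Qv] in simp_all)
  have "four_block_mat
      (four_block_mat (- H) (0\<^sub>m M t) (0\<^sub>m t M) (0\<^sub>m t t))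
      (four_block_mat (Q\<^sup>T) (1\<^sub>m M) (0\<^sub>m t p) (- (E\<^sup>T)))
      (four_block_mat Q (0\<^sub>m p t) (1\<^sub>m M) (- E))
      (four_block_mat (0\<^sub>m p p) (0\<^sub>m p M) (0\<^sub>m M p) (0\<^sub>m M M))
      *\<^sub>v ((x @\<^sub>v y) @\<^sub>v (v @\<^sub>v w))
    = (((- (H *\<^sub>v x)) @\<^sub>v 0\<^sub>v t) + ((Q\<^sup>T *\<^sub>v v + w) @\<^sub>v 0\<^sub>v t)) @\<^sub>v ((b @\<^sub>v 0\<^sub>v M) + (0\<^sub>v p @\<^sub>v 0\<^sub>v M))"
    unfolding A[symmetric] B[symmetric] C[symmetric] D[symmetric]
    by (rule four_block_mat_mult_vec[OF four_block_carrier_mat[OF nH zero_carrier_mat]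
          four_block_carrier_mat[OF QT nET] four_block_carrier_mat[OF Q nE]
          four_block_carrier_mat[OF zero_carrier_mat zero_carrier_mat]
          append_carrier_vec[OF xc y] append_carrier_vec[OF v wc]])
  also have "((- (H *\<^sub>v x)) @\<^sub>v 0\<^sub>v t) + ((Q\<^sup>T *\<^sub>v v + w) @\<^sub>v 0\<^sub>v t) = r @\<^sub>v 0\<^sub>v t"
    using append_vec_add[of "- (H *\<^sub>v x)" M "Q\<^sup>T *\<^sub>v v + w" "0\<^sub>v t" t "0\<^sub>v t"] Hx Qv wc 1 by simp
  also have "(b @\<^sub>v 0\<^sub>v M) + (0\<^sub>v p @\<^sub>v 0\<^sub>v M) = b @\<^sub>v 0\<^sub>v M"
    using append_vec_add[of b p "0\<^sub>v p" "0\<^sub>v M" M "0\<^sub>v M"] bc by simp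
  \<comment> \<open>The computation groups the four components two by two; associativity gives the
    right-nested form of the statement.\<close>
  finally show ?thesis by (simp only: append_vec_assoc)
qed

lemma sum_list_upt: "sum_list (map f [0..<n]) = sum f {..<n}"
  by (simp add: interv_sum_list_conv_sum_set_nat lessThan_atLeast0)

section \<open>The blocks of a coupled semidefinite program\<close>

lemma selector_carrier:
  assumes "J \<subseteq> {..<n}"
  shows "selector n J \<in> carrier_mat (card J) n"
proof (rule carrier_matI)
  \<comment> \<open>\<open>submatrix\<close> counts the selected indices below \<open>n\<close>, and
    all of \<open>J\<close> lies there.\<close>
  have "{i. i < n \<and> i \<in> J} = J" using assms by blast
  thus "dim_row (selector n J) = card J" by (simp only: selector_def dim_submatrix index_one_mat)
  show "dim_col (selector n J) = n" by (simp add: selector_def dim_submatrix)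
qed

lemma E_blk_carrier:
  assumes "is_coupled_sdp P" "i < nblk P"
  shows "E_blk P i \<in> carrier_mat (bsize P i) (dimX P)"
proof -
  have "(\<Union>i<nblk P. idx P i) = {..<dimX P}" using assms(1) unfolding is_coupled_sdp_def by blast
  hence "idx P i \<subseteq> {..<dimX P}" using assms(2) by blast
  thus ?thesis unfolding E_blk_def bsize_def by (rule selector_carrier)
qed

lemma sub_blk_carrier:
  assumes "is_coupled_sdp P" "i < nblk P"
  shows "sub_blk P A i \<in> carrier_mat (bsize P i) (bsize P i)"
  unfolding sub_blk_def using E_blk_carrier[OF assms] by (intro carrier_matI) simp_all

text \<open>With equal factors the two summands coincide, and the factor one half removes the
  doubling. Stacked over the blocks, this gives the fourth block row.\<close>

lemma skron_E_blk_svec: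
  assumes "is_coupled_sdp P" "i < nblk P" and A: "A \<in> sym_mats (dimX P)"
  shows "(E_blk P i \<otimes>\<^sub>s E_blk P i) *\<^sub>v svec A = svec (sub_blk P A i)"
proof -
  have E: "E_blk P i \<in> carrier_mat (bsize P i) (dimX P)" using E_blk_carrier assms by blast
  have "(1/2) \<cdot>\<^sub>m (sub_blk P A i + sub_blk P A i) = sub_blk P A i"
    by (rule eq_matI) (auto simp: sub_blk_def)
  thus ?thesis using skron(2)[OF E E A] by (simp add: sub_blk_def)
qed

lemma Qcal_carrier: "Qcal P i \<in> carrier_mat (ncon P i) (tri (bsize P i))"
  by (simp add: Qcal_def mat_of_rows_def)

section \<open>Invertibility of the scaling matrices and of the blocks \<open>F_blk\<close>\<close>

lemma is_iterateD:
  assumes "is_iterate P Z" "i < nblk P"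
  shows "pos_def (Xbar P Z i)" "itS Z i \<in> carrier_mat (bsize P i) (bsize P i)" "pos_def (itS Z i)"
    "itG Z i \<in> carrier_mat (bsize P i) (bsize P i)"
    "itG Z i * (itG Z i)\<^sup>T = nt_matrix (Xbar P Z i) (itS Z i)"
  using assms unfolding is_iterate_def sym_mats_def by blast+

text \<open>\<open>itG\<close> is given as a factor of the Nesterov-Todd matrix. The determinant of
  that matrix is nonzero, hence so is that of \<open>itG\<close>, and \<open>D_nt\<close> is a
  genuine inverse.\<close>

lemma D_nt:
  assumes P: "is_coupled_sdp P" and Z: "is_iterate P Z" and i: "i < nblk P"
  shows "D_nt Z i \<in> carrier_mat (bsize P i) (bsize P i)" "det (D_nt Z i) \<noteq> 0"
proof -
  note Zi = is_iterateD[OF Z i]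
  have X: "Xbar P Z i \<in> carrier_mat (bsize P i) (bsize P i)"
    unfolding Xbar_def by (rule sub_blk_carrier[OF P i])
  have GT: "(itG Z i)\<^sup>T \<in> carrier_mat (bsize P i) (bsize P i)" using Zi(4) by simp
  have "det (itG Z i * (itG Z i)\<^sup>T) \<noteq> 0"
    unfolding Zi(5) by (rule nt_matrix_det_nonzero(2)[OF X Zi(1-3)])
  hence G: "det (itG Z i) \<noteq> 0" unfolding det_mult[OF Zi(4) GT] by simp
  show "D_nt Z i \<in> carrier_mat (bsize P i) (bsize P i)" "det (D_nt Z i) \<noteq> 0"
    unfolding D_nt_def using minv_inverse(1)[OF Zi(4) G] det_minv[OF Zi(4) G] .
qed

lemma U_blk_carrier:
  assumes P: "is_coupled_sdp P" and Z: "is_iterate P Z" and i: "i < nblk P"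
  shows "U_blk Z i \<in> carrier_mat (tri (bsize P i)) (tri (bsize P i))"
  unfolding U_blk_def
proof (rule skron(1))
  show "(minv (D_nt Z i))\<^sup>T * itS Z i \<in> carrier_mat (bsize P i) (bsize P i)"
    using minv_inverse(1)[OF D_nt[OF assms]] is_iterateD(2)[OF Z i]
    by (intro mult_carrier_mat) simp_all
qed (rule D_nt(1)[OF assms])

lemma F_blk:
  assumes P: "is_coupled_sdp P" and Z: "is_iterate P Z" and i: "i < nblk P"
  shows "F_blk P Z i \<in> carrier_mat (tri (bsize P i)) (tri (bsize P i))" "det (F_blk P Z i) \<noteq> 0"
proof -
  note D = D_nt[OF assms]
  have X: "Xbar P Z i \<in> carrier_mat (bsize P i) (bsize P i)"
    unfolding Xbar_def by (rule sub_blk_carrier[OF P i])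
  have IT: "(minv (D_nt Z i))\<^sup>T \<in> carrier_mat (bsize P i) (bsize P i)"
    using minv_inverse(1)[OF D] by simp
  show "F_blk P Z i \<in> carrier_mat (tri (bsize P i)) (tri (bsize P i))"
    unfolding F_blk_def by (rule skron(1)[OF mult_carrier_mat[OF D(1) X] IT])
  show "det (F_blk P Z i) \<noteq> 0"
    unfolding F_blk_def by (rule scaled_skron_det_nonzero[OF D X is_iterateD(1)[OF Z i]])
qed

lemma admissible_r_carrier:
  assumes P: "is_coupled_sdp P" and Z: "is_iterate P Z" and r: "admissible_r P Z r" and i: "i < nblk P"
  shows "r i \<in> carrier_vec (tri (bsize P i))"
proof -
  have I: "minv (F_blk P Z i) \<in> carrier_mat (tri (bsize P i)) (tri (bsize P i))"
    using minv_inverse(1)[OF F_blk[OF P Z i]] .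
  \<comment> \<open>Vector subtraction takes its dimension from the second argument, here a product
    with \<open>minv (F_blk P Z i)\<close>.\<close>
  have dim: "u - minv (F_blk P Z i) *\<^sub>v v \<in> carrier_vec (tri (bsize P i))" for u v
    using carrier_matD(1)[OF I] by (intro carrier_vecI) simp
  consider "r = r_predictor P Z" | \<sigma> dXp where "r = r_corrector P Z \<sigma> dXp"
    using r unfolding admissible_r_def by blast
  thus ?thesis by cases (simp_all only: r_predictor_def r_corrector_def dim)
qed

section \<open>Assembled matrices\<close>

lemma F_big:
  assumes P: "is_coupled_sdp P" and Z: "is_iterate P Z"
  defines "M \<equiv> \<Sum>i<nblk P. tri (bsize P i)"
  shows "F_big P Z \<in> carrier_mat M M" "det (F_big P Z) \<noteq> 0"
  unfolding F_big_def M_def sum_list_upt[symmetric] using F_blk[OF P Z]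
  by (intro diag_block_mat_carrier det_diag_block_mat_nonzero; simp)+

lemma Q_big_carrier:
  "Q_big P \<in> carrier_mat (\<Sum>i<nblk P. ncon P i) (\<Sum>i<nblk P. tri (bsize P i))"
  unfolding Q_big_def sum_list_upt[symmetric] by (intro diag_block_mat_carrier Qcal_carrier)

lemma E_big_carrier:
  assumes "is_coupled_sdp P"
  shows "E_big P \<in> carrier_mat (\<Sum>i<nblk P. tri (bsize P i)) (tri (dimX P))"
  unfolding E_big_def sum_list_upt[symmetric]
proof (rule stack_rows_carrier)
  fix i assume "i \<in> set [0..<nblk P]"
  hence "E_blk P i \<in> carrier_mat (bsize P i) (dimX P)" using E_blk_carrier[OF assms] by simp
  thus "E_blk P i \<otimes>\<^sub>s E_blk P i \<in> carrier_mat (tri (bsize P i)) (tri (dimX P))" by (intro skron(1))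
qed

lemma stack_carrier:
  assumes "\<And>i. i < nblk P \<Longrightarrow> f i \<in> carrier_vec (d i)"
  shows "stack P f \<in> carrier_vec (\<Sum>i<nblk P. d i)"
  unfolding stack_def sum_list_upt[symmetric] using assms by (intro stack_vec_carrier) simp

lemma stack_cong: "(\<And>i. i < nblk P \<Longrightarrow> f i = g i) \<Longrightarrow> stack P f = stack P g"
  unfolding stack_def by (intro arg_cong[of _ _ stack_vec] map_cong) auto

lemma E_big_svec:
  assumes P: "is_coupled_sdp P" and A: "A \<in> sym_mats (dimX P)"
  shows "E_big P *\<^sub>v svec A = stack P (\<lambda>i. svec (sub_blk P A i))"
proof -
  have c: "E_blk P i \<otimes>\<^sub>s E_blk P i \<in> carrier_mat (tri (bsize P i)) (tri (dimX P))"
    if "i \<in> set [0..<nblk P]" for i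
    using that E_blk_carrier[OF P, of i] by (intro skron(1)) simp_all
  have "svec A \<in> carrier_vec (tri (dimX P))" using A svec_carrier by (auto simp: sym_mats_def)
  from stack_rows_mult_vec[OF c this]
  have "E_big P *\<^sub>v svec A = stack P (\<lambda>i. (E_blk P i \<otimes>\<^sub>s E_blk P i) *\<^sub>v svec A)"
    unfolding E_big_def stack_def .
  also have "\<dots> = stack P (\<lambda>i. svec (sub_blk P A i))"
    by (rule stack_cong) (rule skron_E_blk_svec[OF P _ A])
  finally show ?thesis .
qed

text \<open>The block vector \<open>y\<close> of the local solutions satisfies \<open>\<^bold>F y = \<^bold>U x\<close>, so \<open>y = \<^bold>F\<^sup>-\<^sup>1 \<^bold>U x\<close>.\<close>
lemma F_big_inv_U_big_stack:
  assumes P: "is_coupled_sdp P" and Z: "is_iterate P Z"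
    and x: "\<And>i. i < nblk P \<Longrightarrow> x i \<in> carrier_vec (tri (bsize P i))"
  shows "(minv (F_big P Z) * U_big P Z) *\<^sub>v stack P x
    = stack P (\<lambda>i. (minv (F_blk P Z i) * U_blk Z i) *\<^sub>v x i)"
proof -
  let ?M = "\<Sum>i<nblk P. tri (bsize P i)"
  \<comment> \<open>\<open>y\<close> applies the inverses block by block; testing it against
    \<open>F_big\<close> replaces a computation of the inverse of a block-diagonal matrix.\<close>
  define y where "y i = (minv (F_blk P Z i) * U_blk Z i) *\<^sub>v x i" for i
  have y: "y i \<in> carrier_vec (tri (bsize P i))" and Fy: "F_blk P Z i *\<^sub>v y i = U_blk Z i *\<^sub>v x i"
    if i: "i < nblk P" for i
  proof -
    note F = F_blk[OF P Z i] note U = U_blk_carrier[OF P Z i] note I = minv_inverse[OF F]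
    show "y i \<in> carrier_vec (tri (bsize P i))"
      unfolding y_def by (rule mult_mat_vec_carrier[OF mult_carrier_mat[OF I(1) U] x[OF i]])
    have Ux: "U_blk Z i *\<^sub>v x i \<in> carrier_vec (tri (bsize P i))" by (rule mult_mat_vec_carrier[OF U x[OF i]])
    have "F_blk P Z i *\<^sub>v y i = F_blk P Z i *\<^sub>v (minv (F_blk P Z i) *\<^sub>v (U_blk Z i *\<^sub>v x i))"
      unfolding y_def assoc_mult_mat_vec[OF I(1) U x[OF i]] ..
    also have "\<dots> = U_blk Z i *\<^sub>v x i"
      unfolding assoc_mult_mat_vec[OF F(1) I(1) Ux, symmetric] I(2) by (rule one_mult_mat_vec[OF Ux])
    finally show "F_blk P Z i *\<^sub>v y i = U_blk Z i *\<^sub>v x i" .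
  qed
  note F = F_big[OF P Z] note I = minv_inverse[OF F]
  have U: "U_big P Z \<in> carrier_mat ?M ?M"
    unfolding U_big_def sum_list_upt[symmetric] using U_blk_carrier[OF P Z]
    by (intro diag_block_mat_carrier) simp
  have xc: "stack P x \<in> carrier_vec ?M" and yc: "stack P y \<in> carrier_vec ?M"
    using x y by (intro stack_carrier; simp)+
  have "F_big P Z *\<^sub>v stack P y = stack P (\<lambda>i. F_blk P Z i *\<^sub>v y i)"
    unfolding F_big_def stack_def using F_blk(1)[OF P Z] y
    by (intro diag_block_mat_mult_stack_vec) simp_all
  also have "\<dots> = stack P (\<lambda>i. U_blk Z i *\<^sub>v x i)" by (rule stack_cong) (rule Fy)
  also have "\<dots> = U_big P Z *\<^sub>v stack P x"
    unfolding U_big_def stack_def using U_blk_carrier[OF P Z] x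
    by (intro diag_block_mat_mult_stack_vec[symmetric]) simp_all
  finally have *: "F_big P Z *\<^sub>v stack P y = U_big P Z *\<^sub>v stack P x" .
  have "(minv (F_big P Z) * U_big P Z) *\<^sub>v stack P x = minv (F_big P Z) *\<^sub>v (F_big P Z *\<^sub>v stack P y)"
    unfolding assoc_mult_mat_vec[OF I(1) U xc] * ..
  also have "\<dots> = stack P y"
    unfolding assoc_mult_mat_vec[OF I(1) F(1) yc, symmetric] I(3) by (rule one_mult_mat_vec[OF yc])
  finally show ?thesis unfolding y_def .
qed

theorem theorem1:
  fixes P :: coupled_sdp and Z :: iterate
    and r dv dxb dvb :: "nat \<Rightarrow> real vec"
    and dX :: "real mat" and dXb :: "nat \<Rightarrow> real mat"
    and dx :: "real vec"
  assumes "is_coupled_sdp P"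
    and "is_iterate P Z"
    and "admissible_r P Z r"
    and "qp_solution P Z r dX"
    and "dx = svec dX"
    and "dual_multipliers P Z r dX dv"
    and "\<And>i. i < nblk P \<Longrightarrow> dXb i = sub_blk P dX i"
    and "\<And>i. i < nblk P \<Longrightarrow> dxb i = svec (dXb i)"
    and "\<And>i. i < nblk P \<Longrightarrow>
           dvb i = (minv (F_blk P Z i) * U_blk Z i) *\<^sub>v dxb i + r i - (Qcal P i)\<^sup>T *\<^sub>v dv i"
  shows "newton_matrix P Z *\<^sub>v
           (stack P dxb @\<^sub>v dx @\<^sub>v stack P dv @\<^sub>v stack P dvb)
         = stack P r @\<^sub>v 0\<^sub>v (tri (dimX P)) @\<^sub>v stack P (r_primal P Z)
             @\<^sub>v 0\<^sub>v (\<Sum>i<nblk P. tri (bsize P i))"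
proof -
  note P = assms(1) and Z = assms(2)
  let ?M = "\<Sum>i<nblk P. tri (bsize P i)" and ?p = "\<Sum>i<nblk P. ncon P i" and ?t = "tri (dimX P)"
  let ?H = "minv (F_big P Z) * U_big P Z"
  let ?h = "\<lambda>i. (minv (F_blk P Z i) * U_blk Z i) *\<^sub>v dxb i"
  let ?q = "\<lambda>i. (Qcal P i)\<^sup>T *\<^sub>v dv i"
  \<comment> \<open>Feasibility places the solution among the symmetric matrices, where
    \<open>E_big_svec\<close> applies.\<close>
  have dX: "dX \<in> sym_mats (dimX P)"
    using assms(4) by (simp add: qp_solution_def qp_feasible_def sparse_sym_def)
  hence dxc: "dx \<in> carrier_vec ?t" unfolding assms(5) using svec_carrier by (auto simp: sym_mats_def)
  note E = E_big_carrier[OF P] and Q = Q_big_carrier[of P]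
  have dxb: "dxb i \<in> carrier_vec (tri (bsize P i))" if "i < nblk P" for i
    unfolding assms(8)[OF that] assms(7)[OF that] using svec_carrier sub_blk_carrier[OF P that] by blast
  have r: "r i \<in> carrier_vec (tri (bsize P i))" if "i < nblk P" for i
    by (rule admissible_r_carrier[OF P Z assms(3) that])
  have dv: "dv i \<in> carrier_vec (ncon P i)" if "i < nblk P" for i
    using assms(6) that unfolding dual_multipliers_def by blast
  have stat: "(E_big P)\<^sup>T *\<^sub>v ((?H * E_big P) *\<^sub>v dx - (Q_big P)\<^sup>T *\<^sub>v stack P dv)
      = - ((E_big P)\<^sup>T *\<^sub>v stack P r)"
    and feas: "(Q_big P * E_big P) *\<^sub>v dx = stack P (r_primal P Z)"
    using assms(6) unfolding dual_multipliers_def assms(5) by blast+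
  have U: "U_big P Z \<in> carrier_mat ?M ?M"
    unfolding U_big_def sum_list_upt[symmetric] using U_blk_carrier[OF P Z]
    by (intro diag_block_mat_carrier) simp
  have H: "?H \<in> carrier_mat ?M ?M"
    by (rule mult_carrier_mat[OF minv_inverse(1)[OF F_big[OF P Z]] U])
  have Ex: "E_big P *\<^sub>v dx = stack P dxb"
    unfolding assms(5) E_big_svec[OF P dX] using assms(7,8) by (intro stack_cong) simp
  have h: "?h i \<in> carrier_vec (tri (bsize P i))" if "i < nblk P" for i
    by (rule mult_mat_vec_carrier[OF mult_carrier_mat[OF minv_inverse(1)[OF F_blk[OF P Z that]]
      U_blk_carrier[OF P Z that]] dxb[OF that]])
  have q: "?q i \<in> carrier_vec (tri (bsize P i))" for i
    using carrier_matD[OF Qcal_carrier[of P i]] by (intro carrier_vecI) simp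
  \<comment> \<open>The blockwise definition of \<open>dvb\<close> is assembled into one equation
    between stacked vectors, the form that \<open>kkt_block_system\<close> expects of
    \<open>w\<close>.\<close>
  have "(Q_big P)\<^sup>T *\<^sub>v stack P dv = stack P ?q"
    unfolding Q_big_def transpose_diag_block_mat stack_def using dv Qcal_carrier[of P]
    by (intro diag_block_mat_mult_stack_vec) simp_all
  moreover have "?H *\<^sub>v stack P dxb = stack P ?h"
    by (rule F_big_inv_U_big_stack[OF P Z dxb])
  moreover have "stack P dvb = stack P (\<lambda>i. ?h i + r i - ?q i)"
    using assms(9) by (rule stack_cong)
  moreover have "stack P (\<lambda>i. ?h i + r i - ?q i) = stack P (\<lambda>i. ?h i + r i) - stack P ?q"
    unfolding stack_def using h r q
    by (intro stack_vec_minus[symmetric, of _ _ "\<lambda>i. tri (bsize P i)"] add_carrier_vec) simp_all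
  moreover have "stack P (\<lambda>i. ?h i + r i) = stack P ?h + stack P r"
    unfolding stack_def using h r
    by (intro stack_vec_add[symmetric, of _ _ "\<lambda>i. tri (bsize P i)"]) simp_all
  ultimately have dvb: "stack P dvb = ?H *\<^sub>v stack P dxb + stack P r - (Q_big P)\<^sup>T *\<^sub>v stack P dv"
    by simp
  show ?thesis
    unfolding newton_matrix_def Let_def
  proof (rule kkt_block_system[OF H E Q dxc _ _ Ex _ _ dvb])
    show "stack P dv \<in> carrier_vec ?p" by (rule stack_carrier[OF dv])
    show "stack P r \<in> carrier_vec ?M" by (rule stack_carrier[OF r])
    \<comment> \<open>The multiplier conditions speak of products with \<open>E_big P\<close> acting
      on \<open>dx\<close>; reassociation and \<open>Ex\<close> restate them for
      \<open>stack P dxb\<close>.\<close>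
    show "Q_big P *\<^sub>v stack P dxb = stack P (r_primal P Z)"
      using feas unfolding assoc_mult_mat_vec[OF Q E dxc] Ex .
    show "(E_big P)\<^sup>T *\<^sub>v (?H *\<^sub>v stack P dxb - (Q_big P)\<^sup>T *\<^sub>v stack P dv)
        = - ((E_big P)\<^sup>T *\<^sub>v stack P r)"
      using stat unfolding assoc_mult_mat_vec[OF H E dxc] Ex .
  qed
qed

end
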